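(* Let $0\le T_0<T_1\le+\infty$, let $\Gamma$ be a network with (strictly positive) Hamiltonians $\{H_\gamma\}$ as described in the context, let $x\mapsto c_x$ be any flux limiter and let $g:\Gamma\to\mathbb{R}$ be Lipschitz continuous. Set $$M_0=\Big(\max_\gamma\,\min\{m : H_\gamma(s,(g\circ\gamma)'(s))\le m \text{ for a.e. } s\in(0,1)\}\Big)\vee\Big(\max_{x\in\mathbf{V}}|c_x|\Big).$$ Then there exists a Lipschitz continuous solution $u:\Gamma\times[T_0,T_1)\to\mathbb{R}$ of (HJ$\Gamma$) in $(T_0,T_1)$ with $u(\cdot,T_0)=g$ such that, for every arc $\gamma$ and every $s\in[0,1]$, the function $t\mapsto u(\gamma(s),t)$ is Lipschitz continuous on $[T_0,T_1)$ with Lipschitz constant at most $M_0$.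
   Context: Network. $\Gamma=\bigcup_{\gamma\in\mathcal{E}}\gamma([0,1])\subset\mathbb{R}^N$, where $\mathcal{E}$ is a finite collection of arcs, i.e. simple $C^1$ curves $\gamma:[0,1]\to\mathbb{R}^N$ with nonvanishing derivative. Together with each arc $\gamma$ one also considers its inverse arc $-\gamma(s)=\gamma(1-s)$ (so the collection of arcs is regarded as closed under inversion). It is assumed that $\gamma((0,1))\cap\gamma'([0,1])=\emptyset$ whenever $\gamma'\ne\gamma$, $\gamma'\neq-\gamma$. Vertices are the initial and terminal points of arcs; $\mathbf{V}$ is the set of vertices. The network is connected (any two vertices are linked by a finite concatenation of arcs) and has no loops ($\gamma(0)\ne\gamma(1)$ for every arc). For $x\in\mathbf{V}$, $\Gamma_x=\{\gamma : \gamma(1)=x\}$. Lipschitz continuity on $\Gamma$ (or $\Gamma\times[T_0,T_1)$) is understood along arcs: a continuous function $g$ on $\Gamma$ (resp. $u$ on $\Gamma\times[T_0,T_1)$) is Lipschitz if $g\circ\gamma$ (resp. $u\circ\gamma$) is Lipschitz on $[0,1]$ (resp. on $[0,1]\times[T_0,T_1)$) for every arc $\gamma$. $a\vee b=\max\{a,b\}$. Hamiltonians. For each arc $\gamma$ a function $H_\gamma:[0,1]\times\mathbb{R}\to\mathbb{R}$ is given, with $H_{-\gamma}(s,p)=H_\gamma(1-s,-p)$. Each $H_\gamma$ is continuous in $(s,p)$, convex in $p$, coercive in $p$ uniformly in $s$, and for every $M>0$ there is $C_M$ with $H_\gamma(s,p)-H_\gamma(s,q)\le C_M|p-q|$ for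 all $s\in[0,1]$, $p,q\in(-M,M)$. Moreover all $H_\gamma$ are strictly positive (standing normalization). Set $c_\gamma=-\max_{s\in[0,1]}\min_{p\in\mathbb{R}}H_\gamma(s,p)$. A flux limiter is a function $x\mapsto c_x$ from $\mathbf{V}$ to $\mathbb{R}$ with $c_x\le\min_{\gamma\in\Gamma_x}c_\gamma$ for all $x$. Equation. For $v:\Gamma\times[T_0,T_1)\to\mathbb{R}$ put $(v\circ\gamma)(s,t)=v(\gamma(s),t)$; $'$ denotes the derivative in $s$ and subscript $t$ that in $t$. (HJ$_\gamma$) is $w_t+H_\gamma(s,w')=0$ in $(0,1)\times(T_0,T_1)$. A subtangent (resp. supertangent) to a function at a point is a $C^1$ function $\varphi$ such that (function $-\varphi$) has a local minimum (resp. maximum) at that point; it is constrained to a closed set $C$ if the point is a minimizer (resp. maximizer) only relative to a neighborhood of it intersected with $C$. A continuous $v:\Gamma\times[T_0,T_1)\to\mathbb{R}$ is a supersolution of (HJ$\Gamma$) in $(T_0,T_1)$ if (i) $v\circ\gamma$ is a viscosity supersolution of (HJ$_\gamma$) for every arc $\gamma$; (ii) for every $x\in\mathbf{V}$, $t_0\in(T_0,T_1)$: if some $C^1$ subtangent $\phi$ to $v(x,\cdot)$ at $t_0$ satisfies $\frac{d}{dt}\phi(t_0)<c_x$, then there is an arc $\gamma\in\Gamma_x$ such that all $C^1$ subtangents $\varphi$, constrained to $[0,1]\times\overline{(T_0,T_1)}$, to $v\circ\gamma$ at $(1,t_0)$ satisfy $\varphi_t(1,t_0)+H_\gamma(1,\varphi'(1,t_0))\ge0$.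 It is a subsolution of (HJ$\Gamma$) in $(T_0,T_1)$ if (i) $v\circ\gamma$ is a viscosity subsolution of (HJ$_\gamma$) for every arc $\gamma$; (ii) for every $x\in\mathbf{V}$, $t_0\in(T_0,T_1)$, all $C^1$ supertangents $\psi$ to $v(x,\cdot)$ at $t_0$ satisfy $\frac{d}{dt}\psi(t_0)\le c_x$. A solution is a continuous function that is both a subsolution and a supersolution. *)

theory Defs
  imports "HOL-Analysis.Analysis"
begin

section \<open>Networks\<close>

text \<open>
  A network is given by its collection of arcs.  Arcs are total functions on the reals, of which only
  the restriction to \<open>{0..1}\<close> carries meaning; the inverse arc is the library's \<^const>\<open>reversepath\<close>.
\<close>

text \<open>The derivative is one-sided at the endpoints, so values outside \<open>{0..1}\<close> play no role.\<close>
definition regular_curve :: "(real \<Rightarrow> real ^ 'n) \<Rightarrow> bool" where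
  "regular_curve \<gamma> \<longleftrightarrow> simple_path \<gamma> \<and>
     (\<exists>D. continuous_on {0..1} D \<and>
          (\<forall>s\<in>{0..1}. (\<gamma> has_vector_derivative D s) (at s within {0..1}) \<and> D s \<noteq> 0))"

definition support :: "(real \<Rightarrow> real ^ 'n) set \<Rightarrow> (real ^ 'n) set" where
  "support E = (\<Union>\<gamma>\<in>E. \<gamma> ` {0..1})"

definition vertices :: "(real \<Rightarrow> real ^ 'n) set \<Rightarrow> (real ^ 'n) set" where
  "vertices E = (\<Union>\<gamma>\<in>E. {\<gamma> 0, \<gamma> 1})"

definition arcs_into :: "(real \<Rightarrow> real ^ 'n) set \<Rightarrow> real ^ 'n \<Rightarrow> (real \<Rightarrow> real ^ 'n) set" where
  "arcs_into E x = {\<gamma> \<in> E. \<gamma> 1 = x}"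

definition network :: "(real \<Rightarrow> real ^ 'n) set \<Rightarrow> bool" where
  "network E \<longleftrightarrow>
     finite E \<and>
     (\<forall>\<gamma>\<in>E. regular_curve \<gamma>) \<and>
     (\<forall>\<gamma>\<in>E. reversepath \<gamma> \<in> E) \<and>
     (\<forall>\<gamma>\<in>E. \<forall>\<gamma>'\<in>E. \<gamma>' \<noteq> \<gamma> \<longrightarrow> \<gamma>' \<noteq> reversepath \<gamma> \<longrightarrow> \<gamma> ` {0<..<1} \<inter> \<gamma>' ` {0..1} = {}) \<and>
     (\<forall>x\<in>vertices E. \<forall>y\<in>vertices E. (x, y) \<in> {(\<gamma> 0, \<gamma> 1) |\<gamma>. \<gamma> \<in> E}\<^sup>*) \<and>
     (\<forall>\<gamma>\<in>E. \<gamma> 0 \<noteq> \<gamma> 1)"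

section \<open>Hamiltonians and flux limiters\<close>

definition hamiltonians ::
    "(real \<Rightarrow> real ^ 'n) set \<Rightarrow> ((real \<Rightarrow> real ^ 'n) \<Rightarrow> real \<Rightarrow> real \<Rightarrow> real) \<Rightarrow> bool" where
  "hamiltonians E H \<longleftrightarrow>
     (\<forall>\<gamma>\<in>E.
        (\<forall>s\<in>{0..1}. \<forall>p. H (reversepath \<gamma>) s p = H \<gamma> (1 - s) (- p)) \<and>
        continuous_on ({0..1} \<times> UNIV) (\<lambda>(s, p). H \<gamma> s p) \<and>
        (\<forall>s\<in>{0..1}. convex_on UNIV (H \<gamma> s)) \<and>
        (\<forall>B. \<exists>R. \<forall>s\<in>{0..1}. \<forall>p. \<bar>p\<bar> \<ge> R \<longrightarrow> H \<gamma> s p \<ge> B) \<and>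
        (\<forall>M>0. \<exists>C. \<forall>s\<in>{0..1}. \<forall>p\<in>{-M<..<M}. \<forall>q\<in>{-M<..<M}. H \<gamma> s p - H \<gamma> s q \<le> C * \<bar>p - q\<bar>) \<and>
        (\<forall>s\<in>{0..1}. \<forall>p. H \<gamma> s p > 0))"

text \<open>
  For Hamiltonians as above the infimum and the supremum are attained, by continuity and uniform
  coercivity: this is \<open>- max\<^sub>s min\<^sub>p H \<gamma> s p\<close>.
\<close>
definition arc_const ::
    "((real \<Rightarrow> real ^ 'n) \<Rightarrow> real \<Rightarrow> real \<Rightarrow> real) \<Rightarrow> (real \<Rightarrow> real ^ 'n) \<Rightarrow> real" where
  "arc_const H \<gamma> = - (SUP s\<in>{0..1}. INF p. H \<gamma> s p)"

definition flux_limiter ::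
    "(real \<Rightarrow> real ^ 'n) set \<Rightarrow> ((real \<Rightarrow> real ^ 'n) \<Rightarrow> real \<Rightarrow> real \<Rightarrow> real) \<Rightarrow> (real ^ 'n \<Rightarrow> real) \<Rightarrow> bool" where
  "flux_limiter E H c \<longleftrightarrow> (\<forall>x\<in>vertices E. c x \<le> Min (arc_const H ` arcs_into E x))"

section \<open>Time intervals and Lipschitz functions\<close>

text \<open>The terminal time is an extended real, since it may be infinite.\<close>

definition time_open :: "real \<Rightarrow> ereal \<Rightarrow> real set" where
  "time_open T0 T1 = {t. T0 < t \<and> ereal t < T1}"

definition time_halfopen :: "real \<Rightarrow> ereal \<Rightarrow> real set" where
  "time_halfopen T0 T1 = {t. T0 \<le> t \<and> ereal t < T1}"

definition lipschitz_space :: "(real \<Rightarrow> real ^ 'n) set \<Rightarrow> (real ^ 'n \<Rightarrow> real) \<Rightarrow> bool" where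
  "lipschitz_space E g \<longleftrightarrow>
     continuous_on (support E) g \<and> (\<forall>\<gamma>\<in>E. \<exists>L. L-lipschitz_on {0..1} (g \<circ> \<gamma>))"

definition lipschitz_spacetime ::
    "(real \<Rightarrow> real ^ 'n) set \<Rightarrow> real \<Rightarrow> ereal \<Rightarrow> (real ^ 'n \<Rightarrow> real \<Rightarrow> real) \<Rightarrow> bool" where
  "lipschitz_spacetime E T0 T1 v \<longleftrightarrow>
     continuous_on (support E \<times> time_halfopen T0 T1) (\<lambda>(x, t). v x t) \<and>
     (\<forall>\<gamma>\<in>E. \<exists>L. L-lipschitz_on ({0..1} \<times> time_halfopen T0 T1) (\<lambda>(s, t). v (\<gamma> s) t))"

section \<open>Viscosity solutions\<close>

definition C1_near :: "('a::real_normed_vector \<Rightarrow> real) \<Rightarrow> 'a \<Rightarrow> bool" where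
  "C1_near \<phi> z \<longleftrightarrow>
     (\<exists>U D. open U \<and> z \<in> U \<and> continuous_on U (D :: 'a \<Rightarrow> 'a \<Rightarrow>\<^sub>L real) \<and>
            (\<forall>y\<in>U. (\<phi> has_derivative blinfun_apply (D y)) (at y)))"

text \<open>
  Test functions to \<open>w\<close> at \<open>z\<close>, constrained to \<open>C\<close>.  The unconstrained notions are obtained with
  \<open>C = UNIV\<close>: they are used only at interior points of the domain of \<open>w\<close>, and they are local.
\<close>

definition subtangent ::
    "'a::real_normed_vector set \<Rightarrow> ('a \<Rightarrow> real) \<Rightarrow> 'a \<Rightarrow> ('a \<Rightarrow> real) \<Rightarrow> bool" where
  "subtangent C w z \<phi> \<longleftrightarrow>
     C1_near \<phi> z \<and> (\<forall>\<^sub>F y in at z within C. w z - \<phi> z \<le> w y - \<phi> y)"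

definition supertangent ::
    "'a::real_normed_vector set \<Rightarrow> ('a \<Rightarrow> real) \<Rightarrow> 'a \<Rightarrow> ('a \<Rightarrow> real) \<Rightarrow> bool" where
  "supertangent C w z \<phi> \<longleftrightarrow>
     C1_near \<phi> z \<and> (\<forall>\<^sub>F y in at z within C. w z - \<phi> z \<ge> w y - \<phi> y)"

text \<open>The left-hand side \<open>\<phi>\<^sub>t + h(s, \<phi>')\<close> of the equation, evaluated at \<open>(s, t)\<close>.\<close>
definition hj_operator :: "(real \<Rightarrow> real \<Rightarrow> real) \<Rightarrow> (real \<times> real \<Rightarrow> real) \<Rightarrow> real \<Rightarrow> real \<Rightarrow> real" where
  "hj_operator h \<phi> s t = deriv (\<lambda>\<tau>. \<phi> (s, \<tau>)) t + h s (deriv (\<lambda>\<sigma>. \<phi> (\<sigma>, t)) s)"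

definition arc_supersolution ::
    "real \<Rightarrow> ereal \<Rightarrow> (real \<Rightarrow> real \<Rightarrow> real) \<Rightarrow> (real \<times> real \<Rightarrow> real) \<Rightarrow> bool" where
  "arc_supersolution T0 T1 h w \<longleftrightarrow>
     (\<forall>s\<in>{0<..<1}. \<forall>t\<in>time_open T0 T1. \<forall>\<phi>.
        subtangent UNIV w (s, t) \<phi> \<longrightarrow> hj_operator h \<phi> s t \<ge> 0)"

definition arc_subsolution ::
    "real \<Rightarrow> ereal \<Rightarrow> (real \<Rightarrow> real \<Rightarrow> real) \<Rightarrow> (real \<times> real \<Rightarrow> real) \<Rightarrow> bool" where
  "arc_subsolution T0 T1 h w \<longleftrightarrow>
     (\<forall>s\<in>{0<..<1}. \<forall>t\<in>time_open T0 T1. \<forall>\<phi>.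
        supertangent UNIV w (s, t) \<phi> \<longrightarrow> hj_operator h \<phi> s t \<le> 0)"

definition hj_supersolution ::
    "(real \<Rightarrow> real ^ 'n) set \<Rightarrow> ((real \<Rightarrow> real ^ 'n) \<Rightarrow> real \<Rightarrow> real \<Rightarrow> real) \<Rightarrow> (real ^ 'n \<Rightarrow> real) \<Rightarrow>
     real \<Rightarrow> ereal \<Rightarrow> (real ^ 'n \<Rightarrow> real \<Rightarrow> real) \<Rightarrow> bool" where
  "hj_supersolution E H c T0 T1 v \<longleftrightarrow>
     continuous_on (support E \<times> time_halfopen T0 T1) (\<lambda>(x, t). v x t) \<and>
     (\<forall>\<gamma>\<in>E. arc_supersolution T0 T1 (H \<gamma>) (\<lambda>(s, t). v (\<gamma> s) t)) \<and>
     (\<forall>x\<in>vertices E. \<forall>t0\<in>time_open T0 T1.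
        (\<exists>\<phi>. subtangent UNIV (v x) t0 \<phi> \<and> deriv \<phi> t0 < c x) \<longrightarrow>
        (\<exists>\<gamma>\<in>arcs_into E x. \<forall>\<phi>.
           subtangent ({0..1} \<times> closure (time_open T0 T1)) (\<lambda>(s, t). v (\<gamma> s) t) (1, t0) \<phi> \<longrightarrow>
           hj_operator (H \<gamma>) \<phi> 1 t0 \<ge> 0))"

definition hj_subsolution ::
    "(real \<Rightarrow> real ^ 'n) set \<Rightarrow> ((real \<Rightarrow> real ^ 'n) \<Rightarrow> real \<Rightarrow> real \<Rightarrow> real) \<Rightarrow> (real ^ 'n \<Rightarrow> real) \<Rightarrow>
     real \<Rightarrow> ereal \<Rightarrow> (real ^ 'n \<Rightarrow> real \<Rightarrow> real) \<Rightarrow> bool" where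
  "hj_subsolution E H c T0 T1 v \<longleftrightarrow>
     continuous_on (support E \<times> time_halfopen T0 T1) (\<lambda>(x, t). v x t) \<and>
     (\<forall>\<gamma>\<in>E. arc_subsolution T0 T1 (H \<gamma>) (\<lambda>(s, t). v (\<gamma> s) t)) \<and>
     (\<forall>x\<in>vertices E. \<forall>t0\<in>time_open T0 T1. \<forall>\<psi>.
        supertangent UNIV (v x) t0 \<psi> \<longrightarrow> deriv \<psi> t0 \<le> c x)"

definition hj_solution ::
    "(real \<Rightarrow> real ^ 'n) set \<Rightarrow> ((real \<Rightarrow> real ^ 'n) \<Rightarrow> real \<Rightarrow> real \<Rightarrow> real) \<Rightarrow> (real ^ 'n \<Rightarrow> real) \<Rightarrow>
     real \<Rightarrow> ereal \<Rightarrow> (real ^ 'n \<Rightarrow> real \<Rightarrow> real) \<Rightarrow> bool" where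
  "hj_solution E H c T0 T1 v \<longleftrightarrow> hj_subsolution E H c T0 T1 v \<and> hj_supersolution E H c T0 T1 v"

section \<open>The Lipschitz bound\<close>

text \<open>
  For \<open>g\<close> Lipschitz along arcs the derivative exists almost everywhere, so its default values elsewhere
  are irrelevant, and the infimum below is a minimum.
\<close>
definition M0 ::
    "(real \<Rightarrow> real ^ 'n) set \<Rightarrow> ((real \<Rightarrow> real ^ 'n) \<Rightarrow> real \<Rightarrow> real \<Rightarrow> real) \<Rightarrow> (real ^ 'n \<Rightarrow> real) \<Rightarrow>
     (real ^ 'n \<Rightarrow> real) \<Rightarrow> real" where
  "M0 E H c g =
     max (MAX \<gamma>\<in>E. Inf {m. AE s\<in>{0<..<1} in lebesgue. H \<gamma> s (deriv (g \<circ> \<gamma>) s) \<le> m})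
         (MAX x\<in>vertices E. \<bar>c x\<bar>)"

end

theory Submission
  imports Defs
begin

text \<open>
  Perron's method, in a form that needs no comparison principle.  A function on an arc is a
  subsolution if its increments are bounded by the support function of the set of admissible gradients
  \<open>(a, p)\<close>, that is, \<open>a + H s p \<le> 0\<close> and \<open>a \<ge> -K\<close>.  This single inequality contains
  the Lipschitz bounds as well as the equation, since the Hamiltonians are convex, coercive and positive,
  and it is stable under arbitrary suprema, finite minima and gluing.  Adding the initial condition
  \<open>w \<le> g\<close> and the slope bound \<open>c x\<close> at the vertices, the supremum \<open>u\<close> of this class belongs to
  the class.  The initial datum is attained because of the barrier \<open>g - M0 (t - T0)\<close>, and comparing
  \<open>u\<close> with its own time translates shows that its time Lipschitz constant is \<open>M0\<close> rather than
  \<open>K > M0\<close>.  If \<open>u\<close> failed to be a supersolution at some point, a piecewise affine bump could be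
  glued onto it, contradicting maximality.
\<close>

text \<open>Perron's method usually produces semicontinuous envelopes, and only a comparison
  principle shows that they coincide. The floor \<open>a \<ge> -K\<close> avoids this: with
  positivity and coercivity it makes the sets of gradients bounded, so the whole class is
  equi-Lipschitz and its supremum is continuous. Stability comes from the shape of the condition: a
  bound \<open>m\<close> on increments that is common to all competitors passes to suprema.
  Convexity enters when the increment bound is turned into the viscosity inequality, because a
  support function sees only the closed convex hull. The two parts of \<open>M0\<close> have
  separate tasks: the first makes \<open>(-M0, g')\<close> an admissible gradient almost everywhere,
  the second gives \<open>-M0 \<le> c x\<close>, so that the barrier obeys the vertex condition. The
  sharp time rate is more than a byproduct: it forces subtangents to have time slope at least
  \<open>-M0\<close>, and the gap between \<open>M0\<close> and \<open>K\<close> then lets a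
  competitor perturb that slope. The main obstacle is a vertex, where the failing test functions of
  different arcs may have different time slopes, while a competitor must be single-valued.\<close>

section \<open>Lipschitz functions of one real variable\<close>

text \<open>The density is obtained by differentiating the push-forward of Lebesgue measure under the inverse
  of the bi-Lipschitz homeomorphism \<open>f x + (L + 1) x\<close>.\<close>

lemma lipschitz_has_density:
  fixes f :: "real \<Rightarrow> real"
  assumes f: "L-lipschitz_on UNIV f"
  obtains \<rho> where "\<And>a b. a \<le> b \<Longrightarrow> (\<rho> has_integral (f b - f a)) {a..b}"
proof -
  define F where "F x = f x + (L + 1) * x" for x
  have L0: "0 \<le> L" using f lipschitz_on_nonneg by blast
  have fd: "\<bar>f x - f y\<bar> \<le> L * \<bar>x - y\<bar>" for x y
    using lipschitz_onD[OF f, of x y] by (simp add: dist_real_def)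
  \<comment> \<open>\<open>F\<close> expands distances, which makes its inverse 1-Lipschitz and
    hence measurable.\<close>
  have Finc: "F y - F x \<ge> y - x" if "x \<le> y" for x y
    using fd[of x y] that by (simp add: F_def algebra_simps)
  have Flip: "\<bar>F y - F x\<bar> \<le> (2 * L + 1) * \<bar>y - x\<bar>" for x y
  proof -
    have "\<bar>F y - F x\<bar> \<le> \<bar>f y - f x\<bar> + \<bar>(L + 1) * (y - x)\<bar>"
      unfolding F_def by (simp add: algebra_simps)
    also have "\<bar>(L + 1) * (y - x)\<bar> = (L + 1) * \<bar>y - x\<bar>" using L0 by (simp add: abs_mult)
    finally show ?thesis using fd[of y x] by (simp add: algebra_simps)
  qed
  have Fmono: "F x < F y" if "x < y" for x y using Finc[of x y] that by simp
  have Finj: "inj F" by (rule injI) (metis Fmono less_irrefl linorder_neqE)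
  have Fcont: "continuous_on UNIV F"
    unfolding F_def using lipschitz_on_continuous_on[OF f] by (intro continuous_intros)
  have Fsurj: "\<exists>x. F x = y" for y
  proof -
    define r where "r = \<bar>y - F 0\<bar>"
    have "F (- r) \<le> y" "y \<le> F r" using Finc[of "-r" 0] Finc[of 0 r] by (auto simp: r_def)
    moreover have "- r \<le> r" by (simp add: r_def)
    ultimately show ?thesis
      using IVT'[of F "-r" y r] continuous_on_subset[OF Fcont] by blast
  qed
  define G where "G = inv F"
  have FG[simp]: "F (G y) = y" for y unfolding G_def using Fsurj by (metis f_inv_into_f rangeI)
  have GF[simp]: "G (F x) = x" for x unfolding G_def using Finj by simp
  have Gvim: "G -` A = F ` A" for A by force
  have "1-lipschitz_on UNIV G"
  proof (rule lipschitz_onI)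
    fix x y :: real
    show "dist (G x) (G y) \<le> 1 * dist x y"
      using Finc[of "G x" "G y"] Finc[of "G y" "G x"] by (cases "G x \<le> G y") (auto simp: dist_real_def)
  qed simp
  then have Gmeas[measurable]: "G \<in> borel_measurable borel"
    using borel_measurable_continuous_onI lipschitz_on_continuous_on by blast
  \<comment> \<open>\<open>\<mu>\<close> gives a set the Lebesgue measure of its image under
    \<open>F\<close>, so on intervals it gives the increments of \<open>F\<close>; it is absolutely
    continuous because \<open>F\<close> is Lipschitz.\<close>
  define \<mu> where "\<mu> = distr lborel borel G"
  have em: "emeasure \<mu> A = emeasure lborel (F ` A)" if "A \<in> sets borel" for A
    using that unfolding \<mu>_def by (simp add: emeasure_distr Gvim)
  have "absolutely_continuous lborel \<mu>"
    unfolding absolutely_continuous_def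
  proof
    fix A :: "real set" assume A: "A \<in> null_sets lborel"
    then have "negligible A" using negligible_iff_null_sets null_sets_completionI by blast
    then have "negligible (F ` A)"
      apply (rule negligible_locally_Lipschitz_image[rotated])
       using Flip by (auto intro!: exI[of _ UNIV] exI[of _ "2*L+1"])
    moreover have "F ` A \<in> sets borel"
      using measurable_sets[OF Gmeas, of A] A by (simp add: Gvim null_sets_def)
    ultimately have "emeasure lborel (F ` A) = 0"
      by (simp add: negligible_iff_null_sets null_sets_def)
    then show "A \<in> null_sets \<mu>" using A em[of A] by (auto simp: null_sets_def \<mu>_def)
  qed
  then obtain q where q: "q \<in> borel_measurable lborel" and dq: "density lborel q = \<mu>"
    using sigma_finite_measure.Radon_Nikodym[OF lborel.sigma_finite_measure_axioms, of \<mu>]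
    by (auto simp: \<mu>_def)
  define \<rho> where "\<rho> x = enn2real (q x)" for x
  have qm[measurable]: "q \<in> borel_measurable borel" using q by simp
  have int: "(\<rho> has_integral (F b - F a)) {a..b}" if ab: "a \<le> b" for a b
  proof -
    have img: "F ` {a..b} = {F a..F b}"
    proof
      show "F ` {a..b} \<subseteq> {F a..F b}" using Finc by force
      show "{F a..F b} \<subseteq> F ` {a..b}"
      proof
        fix y assume "y \<in> {F a..F b}"
        then have "\<not> G y < a" "\<not> b < G y" using Fmono[of "G y" a] Fmono[of b "G y"] by auto
        then show "y \<in> F ` {a..b}" by (intro image_eqI[of _ _ "G y"]) auto
      qed
    qed
    have ge: "F b - F a \<ge> 0" using Finc[OF ab] ab by simp
    have I: "(\<integral>\<^sup>+x. q x * indicator {a..b} x \<partial>lborel) = ennreal (F b - F a)"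
      using em[of "{a..b}"] ge dq emeasure_density[OF q, of "{a..b}"] by (simp add: img)
    \<comment> \<open>The Radon-Nikodym density may take the value infinity, but its integral over a
      bounded interval is finite, so \<open>enn2real\<close> changes it only on a null set.\<close>
    then have "AE x in lborel. q x * indicator {a..b} x \<noteq> \<infinity>"
      by (intro nn_integral_PInf_AE) auto
    then have "AE x in lborel. q x * indicator {a..b} x = ennreal (\<rho> x * indicator {a..b} x)"
      by eventually_elim (auto simp: \<rho>_def indicator_def less_top)
    then have "(\<integral>\<^sup>+x. ennreal (\<rho> x * indicator {a..b} x) \<partial>lborel) = ennreal (F b - F a)"
      using I by (simp cong: nn_integral_cong_AE)
    then have "((\<lambda>x. \<rho> x * indicator {a..b} x) has_integral (F b - F a)) UNIV"
      using ge by (intro nn_integral_has_integral) (auto simp: \<rho>_def)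
    moreover have "(\<lambda>x. \<rho> x * indicator {a..b} x) = (\<lambda>x. if x \<in> {a..b} then \<rho> x else 0)"
      by (auto simp: indicator_def)
    ultimately show ?thesis using has_integral_restrict_UNIV[of "{a..b}" \<rho>] by simp
  qed
  show thesis
  proof (rule that)
    fix a b :: real assume ab: "a \<le> b"
    have "((\<lambda>x. \<rho> x - (L + 1)) has_integral ((F b - F a) - (L + 1) * (b - a))) {a..b}"
      using has_integral_diff[OF int[OF ab] has_integral_const_real[of "L+1" a b]] ab
      by (simp add: mult.commute)
    then show "((\<lambda>x. \<rho> x - (L + 1)) has_integral (f b - f a)) {a..b}"
      by (simp add: F_def algebra_simps)
  qed
qed

text \<open>Lebesgue differentiation of the density. Averages over intervals to the right of
  \<open>x\<close> give the right difference quotients; the left ones come from the same theorem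
  applied to the reflected density.\<close>

lemma lipschitz_has_derivative_ae:
  fixes f :: "real \<Rightarrow> real"
  assumes f: "L-lipschitz_on UNIV f"
  obtains \<rho> N where "negligible N" "\<And>x. x \<notin> N \<Longrightarrow> (f has_real_derivative \<rho> x) (at x)"
    "\<And>a b. a \<le> b \<Longrightarrow> (\<rho> has_integral (f b - f a)) {a..b}"
proof -
  obtain \<rho> where \<rho>: "\<And>a b. a \<le> b \<Longrightarrow> (\<rho> has_integral (f b - f a)) {a..b}"
    using lipschitz_has_density[OF f] by blast
  have "\<rho> integrable_on cbox a b" for a b
    using \<rho>[of a b] by (cases "a \<le> b") auto
  then obtain N1 where N1: "negligible N1"
    "\<And>x e. \<lbrakk>x \<notin> N1; 0 < e\<rbrakk> \<Longrightarrow> \<exists>d>0. \<forall>h. 0 < h \<and> h < d \<longrightarrow>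
        norm(integral (cbox x (x + h *\<^sub>R One)) \<rho> /\<^sub>R h ^ DIM(real) - \<rho> x) < e"
    by (rule integrable_ccontinuous_explicit[of \<rho>]) blast
  have "(\<lambda>x. \<rho> (- x)) integrable_on cbox a b" for a b
    using \<rho>[of "-b" "-a"] Henstock_Kurzweil_Integration.integrable_reflect_real[where f=\<rho> and a="-b" and b="-a"]
    by (cases "a \<le> b") auto
  then obtain N2 where N2: "negligible N2"
    "\<And>x e. \<lbrakk>x \<notin> N2; 0 < e\<rbrakk> \<Longrightarrow> \<exists>d>0. \<forall>h. 0 < h \<and> h < d \<longrightarrow>
        norm(integral (cbox x (x + h *\<^sub>R One)) (\<lambda>x. \<rho> (-x)) /\<^sub>R h ^ DIM(real) - \<rho> (-x)) < e"
    by (rule integrable_ccontinuous_explicit[of "\<lambda>x. \<rho> (-x)"]) blast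
  show thesis
  proof (rule that)
    show "negligible (N1 \<union> uminus ` N2)"
      using N1(1) N2(1) 
      by (intro negligible_Un negligible_differentiable_image_negligible[OF order_refl])
        (auto intro: differentiable_on_minus differentiable_on_ident)
    fix x assume x: "x \<notin> N1 \<union> uminus ` N2"
    then have x1: "x \<notin> N1" and x2: "- x \<notin> N2" by force+
    show "(f has_real_derivative \<rho> x) (at x)"
      unfolding DERIV_def LIM_eq
    proof (intro allI impI)
      fix e :: real assume e: "0 < e"
      obtain d1 where d1: "d1 > 0" and d1': "\<forall>h. 0 < h \<and> h < d1 \<longrightarrow>
          norm (integral (cbox x (x + h *\<^sub>R One)) \<rho> /\<^sub>R h ^ DIM(real) - \<rho> x) < e"
        using N1(2)[OF x1 e] by blast
      have d1r: "\<bar>(f (x + h) - f x) / h - \<rho> x\<bar> < e" if h: "0 < h" "h < d1" for h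
      proof -
        have "integral {x..x+h} \<rho> = f (x + h) - f x" using \<rho>[of x "x + h"] h by (intro integral_unique) auto
        then show ?thesis using d1'[rule_format, of h] h by (simp add: divide_inverse mult.commute)
      qed
      obtain d2 where d2: "d2 > 0" and d2i: "\<forall>h. 0 < h \<and> h < d2 \<longrightarrow>
          norm (integral (cbox (-x) (-x + h *\<^sub>R One)) (\<lambda>x. \<rho> (-x)) /\<^sub>R h ^ DIM(real) - \<rho> (-(-x))) < e"
        using N2(2)[OF x2 e] by blast
      have d2': "\<bar>(f x - f (x - h)) / h - \<rho> x\<bar> < e" if h: "0 < h" "h < d2" for h
      proof -
        have "integral {-x..-(x-h)} (\<lambda>x. \<rho> (-x)) = integral {x-h..x} \<rho>"
          by (rule Henstock_Kurzweil_Integration.integral_reflect_real)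
        also have "\<dots> = f x - f (x - h)" using \<rho>[of "x-h" x] h by (intro integral_unique) auto
        finally show ?thesis using d2i[rule_format, of h] h by (simp add: divide_inverse mult.commute)
      qed
      show "\<exists>s>0. \<forall>h. h \<noteq> 0 \<and> norm (h - 0) < s \<longrightarrow> norm ((f (x + h) - f x) / h - \<rho> x) < e"
      proof (intro exI[of _ "min d1 d2"] conjI allI impI)
        fix h :: real assume h: "h \<noteq> 0 \<and> norm (h - 0) < min d1 d2"
        show "norm ((f (x + h) - f x) / h - \<rho> x) < e"
        proof (cases "h > 0")
          case True then show ?thesis using h d1r[of h] by simp
        next
          case False
          then have "(f x - f (x - (-h))) / (-h) = (f (x + h) - f x) / h"
            using h by (simp add: field_simps)
          then show ?thesis using False h d2'[of "-h"] by simp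
        qed
      qed (use d1 d2 in auto)
    qed
  qed (use \<rho> in auto)
qed

text \<open>The factor \<open>e\<close> is a signed displacement: its sign covers increments to the
  right, to the left, and the case of no displacement. Points of non-differentiability, where
  \<open>deriv\<close> is arbitrary, form a null set.\<close>

lemma lipschitz_increment_le:
  fixes f :: "real \<Rightarrow> real"
  assumes f: "L-lipschitz_on UNIV f" and "a \<le> b"
    and ae: "AE x in lebesgue. a < x \<and> x < b \<longrightarrow> e * deriv f x \<le> \<beta>"
  shows "e * (f b - f a) \<le> \<beta> * (b - a)"
proof -
  obtain \<rho> N where N: "negligible N" "\<And>x. x \<notin> N \<Longrightarrow> (f has_real_derivative \<rho> x) (at x)"
    and \<rho>: "(\<rho> has_integral (f b - f a)) {a..b}"
    by (rule lipschitz_has_derivative_ae[OF f]) (use assms(2) in blast)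
  obtain N' where "N' \<in> null_sets lebesgue" and
    sub: "{x \<in> space lebesgue. \<not> (a < x \<and> x < b \<longrightarrow> e * deriv f x \<le> \<beta>)} \<subseteq> N'"
    using ae unfolding eventually_ae_filter by blast
  then have N': "negligible N'" by (simp add: negligible_iff_null_sets)
  let ?M = "N \<union> N' \<union> {a, b}"
  have M: "negligible ?M" using N N' by auto
  \<comment> \<open>Giving the integrand the value \<beta> on the null sets and at the endpoints
    makes the pointwise bound hold everywhere, as the comparison of integrals demands.\<close>
  define r where "r x = (if x \<in> ?M then \<beta> else e * \<rho> x)" for x
  have "(r has_integral (e * (f b - f a))) {a..b}"
    by (rule has_integral_spike[OF M _ has_integral_mult_right[OF \<rho>]]) (auto simp: r_def)
  moreover have "((\<lambda>x. \<beta>) has_integral (\<beta> * (b - a))) {a..b}"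
    using has_integral_const_real[of \<beta> a b] assms(2) by (simp add: mult.commute)
  moreover have "r x \<le> \<beta>" if "x \<in> {a..b}" for x
  proof (cases "x \<in> ?M")
    case False
    then have "deriv f x = \<rho> x" using N(2)[of x] by (intro DERIV_imp_deriv) auto
    moreover have "e * deriv f x \<le> \<beta>" using False that sub by (auto simp: subset_iff less_le)
    ultimately show ?thesis by (simp add: r_def)
  qed (simp add: r_def)
  ultimately show ?thesis by (rule has_integral_le)
qed

text \<open>Constant extension beyond the endpoints keeps the Lipschitz constant and brings the
  almost-everywhere results on the line to data given on an arc.\<close>

lemma lipschitz_clamp:
  fixes f :: "real \<Rightarrow> real"
  assumes f: "L-lipschitz_on {0..1} f"
  obtains G where "L-lipschitz_on UNIV G" "\<And>x. x \<in> {0..1} \<Longrightarrow> G x = f x"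
    "\<And>x. 0 < x \<Longrightarrow> x < 1 \<Longrightarrow> deriv G x = deriv f x"
proof
  define G where "G x = f (max 0 (min 1 x))" for x
  show "L-lipschitz_on UNIV G"
  proof (rule lipschitz_onI)
    fix x y :: real
    have "dist (G x) (G y) \<le> L * dist (max 0 (min 1 x)) (max 0 (min 1 y))"
      using lipschitz_onD[OF f, of "max 0 (min 1 x)" "max 0 (min 1 y)"] by (simp add: G_def)
    also have "\<dots> \<le> L * dist x y"
      using lipschitz_on_nonneg[OF f] by (intro mult_left_mono) (auto simp: dist_real_def)
    finally show "dist (G x) (G y) \<le> L * dist x y" .
  qed (use lipschitz_on_nonneg[OF f] in auto)
  show "G x = f x" if "x \<in> {0..1}" for x using that by (simp add: G_def)
  show "deriv G x = deriv f x" if "0 < x" "x < 1" for x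
  proof (rule deriv_cong_ev)
    have "eventually (\<lambda>y. y \<in> {0<..<1}) (nhds x)" using that by (intro eventually_nhds_in_open) auto
    then show "\<forall>\<^sub>F y in nhds x. G y = f y" by eventually_elim (simp add: G_def)
  qed simp
qed

lemma real_derivative_lipschitz_bound:
  fixes f :: "real \<Rightarrow> real"
  assumes f: "L-lipschitz_on UNIV f" and d: "(f has_real_derivative D) (at x)"
  shows "\<bar>D\<bar> \<le> L"
proof (rule tendsto_upperbound)
  show "((\<lambda>h. \<bar>(f (x + h) - f x) / h\<bar>) \<longlongrightarrow> \<bar>D\<bar>) (at 0)"
    using d unfolding DERIV_def by (rule tendsto_rabs)
  have "\<bar>(f (x + h) - f x) / h\<bar> \<le> L" if "h \<noteq> 0" for h
    using lipschitz_onD[OF f, of "x + h" x] that by (simp add: dist_real_def abs_divide divide_le_eq)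
  then show "\<forall>\<^sub>F h in at 0. \<bar>(f (x + h) - f x) / h\<bar> \<le> L"
    by (simp add: eventually_at_filter)
qed simp

section \<open>Subsolutions on a single arc\<close>

text \<open>Pairs are (time slope, space slope). The union over the cell
  \<open>{\<alpha>..\<beta>}\<close> allows increments between points with different
  \<open>s\<close>; the Hamiltonian at a single \<open>s\<close> is recovered by shrinking the
  cell.\<close>

definition gradients :: "(real \<Rightarrow> real \<Rightarrow> real) \<Rightarrow> real \<Rightarrow> real \<Rightarrow> real \<Rightarrow> (real \<times> real) set" where
  "gradients h K \<alpha> \<beta> = {(a, p). - K \<le> a \<and> (\<exists>s\<in>{\<alpha>..\<beta>}. a + h s p \<le> 0)}"

text \<open>The increment of \<open>f\<close> is at most the support function of \<open>Z\<close>.  Quantifying over the upper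
  bounds \<open>m\<close> avoids the supremum, which has a junk value when \<open>Z\<close> is empty.\<close>

definition increment_le ::
    "(real \<times> real) set \<Rightarrow> (real \<Rightarrow> real \<Rightarrow> real) \<Rightarrow> real \<Rightarrow> real \<Rightarrow> real \<Rightarrow> real \<Rightarrow> bool" where
  "increment_le Z f s t s' t' \<longleftrightarrow>
     (\<forall>m. (\<forall>(a, p)\<in>Z. a * (t' - t) + p * (s' - s) \<le> m) \<longrightarrow> f s' t' - f s t \<le> m)"

text \<open>Degenerate intervals \<open>\<alpha> = \<beta>\<close> are excluded because the gradient of the barrier is controlled
  only almost everywhere.\<close>

definition admissible ::
    "(real \<Rightarrow> real \<Rightarrow> real) \<Rightarrow> real \<Rightarrow> real set \<Rightarrow> (real \<Rightarrow> real \<Rightarrow> real) \<Rightarrow> bool" where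
  "admissible h K T f \<longleftrightarrow>
     (\<forall>\<alpha> \<beta>. 0 \<le> \<alpha> \<longrightarrow> \<alpha> < \<beta> \<longrightarrow> \<beta> \<le> 1 \<longrightarrow> (\<forall>s\<in>{\<alpha>..\<beta>}. \<forall>s'\<in>{\<alpha>..\<beta>}. \<forall>t\<in>T. \<forall>t'\<in>T.
        increment_le (gradients h K \<alpha> \<beta>) f s t s' t'))"

section \<open>Calculus of increment bounds: localisation, reversal and gluing\<close>

lemma admissibleD:
  assumes "admissible h K T f" "0 \<le> \<alpha>" "\<alpha> < \<beta>" "\<beta> \<le> 1" "s \<in> {\<alpha>..\<beta>}" "s' \<in> {\<alpha>..\<beta>}" "t \<in> T" "t' \<in> T"
  shows "increment_le (gradients h K \<alpha> \<beta>) f s t s' t'"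
  using assms unfolding admissible_def by blast

lemma increment_leD:
  assumes "increment_le Z f s t s' t'" "\<And>a p. (a, p) \<in> Z \<Longrightarrow> a * (t' - t) + p * (s' - s) \<le> m"
  shows "f s' t' - f s t \<le> m"
  using assms unfolding increment_le_def by auto

lemma increment_leI:
  assumes "\<And>m. (\<And>a p. (a, p) \<in> Z \<Longrightarrow> a * (t' - t) + p * (s' - s) \<le> m) \<Longrightarrow> f s' t' - f s t \<le> m"
  shows "increment_le Z f s t s' t'"
  using assms unfolding increment_le_def by auto

lemma increment_le_max:
  assumes "increment_le Z f s t s' t'" "increment_le Z g s t s' t'"
  shows "increment_le Z (\<lambda>s t. max (f s t) (g s t)) s t s' t'"
  using assms unfolding increment_le_def by (fastforce simp: max_def)

lemma increment_le_min:
  assumes "increment_le Z f s t s' t'" "increment_le Z g s t s' t'"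
  shows "increment_le Z (\<lambda>s t. min (f s t) (g s t)) s t s' t'"
  using assms unfolding increment_le_def by (fastforce simp: min_def)

lemma increment_le_gradient:
  assumes "(a, p) \<in> Z" "f s' t' - f s t \<le> a * (t' - t) + p * (s' - s)"
  shows "increment_le Z f s t s' t'"
  using assms unfolding increment_le_def by fastforce

text \<open>Increments add up along a segment, and the fraction \<open>y - x\<close> of the segment
  accounts for the same fraction of the bound \<open>m\<close>. Bisection therefore reduces the
  claim to short pieces around one point.\<close>

lemma admissible_local:
  assumes T: "is_interval T"
    and loc: "\<And>s0 t0. s0 \<in> {0..1} \<Longrightarrow> t0 \<in> T \<Longrightarrow> \<exists>d>0. \<forall>\<alpha> \<beta> s t.
      0 \<le> \<alpha> \<and> \<alpha> < \<beta> \<and> \<beta> \<le> 1 \<and> s0 \<in> {\<alpha>..\<beta>} \<and> s \<in> {\<alpha>..\<beta>} \<and> t \<in> T \<and> \<bar>s - s0\<bar> < d \<and> \<bar>t - t0\<bar> < d \<longrightarrow>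
      increment_le (gradients h K \<alpha> \<beta>) f s0 t0 s t \<and> increment_le (gradients h K \<alpha> \<beta>) f s t s0 t0"
  shows "admissible h K T f"
  unfolding admissible_def
proof (intro allI impI ballI increment_leI)
  fix \<alpha> \<beta> s s' t t' m
  assume ab: "0 \<le> \<alpha>" "\<alpha> < \<beta>" "\<beta> \<le> 1" and s: "s \<in> {\<alpha>..\<beta>}" "s' \<in> {\<alpha>..\<beta>}" and t: "t \<in> T" "t' \<in> T"
    and m: "\<And>a p. (a, p) \<in> gradients h K \<alpha> \<beta> \<Longrightarrow> a * (t' - t) + p * (s' - s) \<le> m"
  define S where "S x = s + x * (s' - s)" for x
  define U where "U x = t + x * (t' - t)" for x
  define P where "P x y \<longleftrightarrow> 0 \<le> x \<longrightarrow> y \<le> 1 \<longrightarrow> f (S y) (U y) - f (S x) (U x) \<le> m * (y - x)" for x y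
  have "convex {\<alpha>..\<beta>}" "convex T" using T by (auto simp: is_interval_convex_1)
  then have mem: "S x \<in> {\<alpha>..\<beta>}" "U x \<in> T" if "0 \<le> x" "x \<le> 1" for x
  proof -
    have "(1 - x) *\<^sub>R s + x *\<^sub>R s' \<in> {\<alpha>..\<beta>}" "(1 - x) *\<^sub>R t + x *\<^sub>R t' \<in> T"
      using s t that \<open>convex {\<alpha>..\<beta>}\<close> \<open>convex T\<close> by (auto intro!: convexD simp del: atLeastAtMost_iff real_scaleR_def)
    then show "S x \<in> {\<alpha>..\<beta>}" "U x \<in> T" by (simp_all add: S_def U_def algebra_simps)
  qed
  have inc: "f (S y) (U y) - f (S x) (U x) \<le> m * (y - x)"
    if "x \<le> y" "increment_le (gradients h K \<alpha> \<beta>) f (S x) (U x) (S y) (U y)" for x y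
  proof (rule increment_leD[OF that(2)])
    fix a p assume "(a, p) \<in> gradients h K \<alpha> \<beta>"
    then have "(a * (t' - t) + p * (s' - s)) * (y - x) \<le> m * (y - x)"
      using m that(1) by (intro mult_right_mono) auto
    then show "a * (U y - U x) + p * (S y - S x) \<le> m * (y - x)"
      by (simp add: S_def U_def algebra_simps)
  qed
  have "P 0 1"
  proof (rule Bolzano)
    fix a b c assume P: "P a b" "P b c" "a \<le> b" "b \<le> c"
    then show "P a c" unfolding P_def by (auto simp: algebra_simps)
  next
    fix x :: real assume x: "0 \<le> x" "x \<le> 1"
    have "S x \<in> {0..1}" using mem(1)[OF x] ab by auto
    from loc[OF this mem(2)[OF x]] obtain d where d: "d > 0" and loc': "\<forall>\<alpha> \<beta> s t.
      0 \<le> \<alpha> \<and> \<alpha> < \<beta> \<and> \<beta> \<le> 1 \<and> S x \<in> {\<alpha>..\<beta>} \<and> s \<in> {\<alpha>..\<beta>} \<and> t \<in> T \<and> \<bar>s - S x\<bar> < d \<and> \<bar>t - U x\<bar> < d \<longrightarrow>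
      increment_le (gradients h K \<alpha> \<beta>) f (S x) (U x) s t \<and> increment_le (gradients h K \<alpha> \<beta>) f s t (S x) (U x)"
      by (elim exE conjE)
    have dd: "increment_le (gradients h K \<alpha> \<beta>) f (S x) (U x) s t \<and> increment_le (gradients h K \<alpha> \<beta>) f s t (S x) (U x)"
      if "s \<in> {\<alpha>..\<beta>}" "t \<in> T" "\<bar>s - S x\<bar> < d" "\<bar>t - U x\<bar> < d" for s t
      using that ab mem(1)[OF x] by (intro loc'[rule_format]) simp
    define l where "l = 1 + \<bar>s' - s\<bar> + \<bar>t' - t\<bar>"
    have l: "l > 0" "\<bar>s' - s\<bar> \<le> l" "\<bar>t' - t\<bar> \<le> l" by (auto simp: l_def)
    have close: "\<bar>S y - S x\<bar> < d" "\<bar>U y - U x\<bar> < d" if "\<bar>y - x\<bar> < d / l" for y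
    proof -
      have "S y - S x = (y - x) * (s' - s)" "U y - U x = (y - x) * (t' - t)"
        by (simp_all add: S_def U_def algebra_simps)
      moreover have "\<bar>y - x\<bar> * \<bar>s' - s\<bar> \<le> \<bar>y - x\<bar> * l" "\<bar>y - x\<bar> * \<bar>t' - t\<bar> \<le> \<bar>y - x\<bar> * l"
        using l by (auto intro: mult_left_mono)
      moreover have "\<bar>y - x\<bar> * l < d" using that l by (simp add: field_simps)
      ultimately show "\<bar>S y - S x\<bar> < d" "\<bar>U y - U x\<bar> < d" by (auto simp: abs_mult)
    qed
    show "\<exists>d>0. \<forall>a b. a \<le> x \<and> x \<le> b \<and> b - a < d \<longrightarrow> P a b"
    proof (intro exI[of _ "d / l"] conjI allI impI)
      show "d / l > 0" using d l by simp
      fix a b assume h: "a \<le> x \<and> x \<le> b \<and> b - a < d / l"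
      show "P a b" unfolding P_def
      proof (intro impI)
        assume "0 \<le> a" "b \<le> 1"
        \<comment> \<open>The short interval contains \<open>x\<close> and is cut there: one half
          ends at the centre and the other starts at it, hence the two directions in the
          hypothesis.\<close>
        then have "f (S x) (U x) - f (S a) (U a) \<le> m * (x - a)" "f (S b) (U b) - f (S x) (U x) \<le> m * (b - x)"
          using h x by (auto intro!: inc conjunct1[OF dd] conjunct2[OF dd] mem close simp del: atLeastAtMost_iff)
        then show "f (S b) (U b) - f (S a) (U a) \<le> m * (b - a)" by (simp add: algebra_simps)
      qed
    qed
  qed simp
  then show "f s' t' - f s t \<le> m" by (simp add: P_def S_def U_def)
qed

text \<open>Reversal turns a gradient \<open>(a, p)\<close> at \<open>s\<close> into
  \<open>(a, - p)\<close> at \<open>1 - s\<close>.\<close>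

lemma admissible_reverse:
  assumes f: "admissible h K T f" and h: "\<And>s p. s \<in> {0..1} \<Longrightarrow> h' s p = h (1 - s) (- p)"
  shows "admissible h' K T (\<lambda>s. f (1 - s))"
  unfolding admissible_def
proof (intro allI impI ballI increment_leI)
  fix \<alpha> \<beta> s s' t t' m
  assume ab: "0 \<le> \<alpha>" "\<alpha> < \<beta>" "\<beta> \<le> 1" and s: "s \<in> {\<alpha>..\<beta>}" "s' \<in> {\<alpha>..\<beta>}" and t: "t \<in> T" "t' \<in> T"
    and m: "\<And>a p. (a, p) \<in> gradients h' K \<alpha> \<beta> \<Longrightarrow> a * (t' - t) + p * (s' - s) \<le> m"
  have "increment_le (gradients h K (1 - \<beta>) (1 - \<alpha>)) f (1 - s) t (1 - s') t'"
    using ab s t by (intro admissibleD[OF f]) auto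
  then show "f (1 - s') t' - f (1 - s) t \<le> m"
  proof (rule increment_leD)
    fix a p assume "(a, p) \<in> gradients h K (1 - \<beta>) (1 - \<alpha>)"
    then obtain r where r: "- K \<le> a" "r \<in> {1 - \<beta>..1 - \<alpha>}" "a + h r p \<le> 0" by (auto simp: gradients_def)
    then have "h' (1 - r) (- p) = h r p" using ab h[of "1 - r" "- p"] by auto
    then have "(a, - p) \<in> gradients h' K \<alpha> \<beta>"
      using r ab by (auto simp: gradients_def intro!: bexI[of _ "1 - r"])
    then show "a * (t' - t) + p * (1 - s' - (1 - s)) \<le> m" using m[of a "-p"] by (simp add: algebra_simps)
  qed
qed

lemma admissible_cong:
  assumes "admissible h K T f" "\<And>s t. s \<in> {0..1} \<Longrightarrow> t \<in> T \<Longrightarrow> g s t = f s t"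
  shows "admissible h K T g"
  using assms unfolding admissible_def increment_le_def by simp

text \<open>The maximum is admissible inside the box. Since \<open>g\<close> lies below
  \<open>f\<close> outside the half-size box, the glued function coincides with \<open>f\<close> in
  a whole ring, and no seam arises at the boundary.\<close>

lemma admissible_max_bump:
  fixes \<sigma> t0 r :: real
  assumes T: "is_interval T" and f: "admissible h K T f" and r: "r > 0"
    and g: "\<And>\<alpha> \<beta> s t s' t'. \<lbrakk>0 \<le> \<alpha>; \<alpha> < \<beta>; \<beta> \<le> 1; s \<in> {\<alpha>..\<beta>}; s' \<in> {\<alpha>..\<beta>}; t \<in> T; t' \<in> T;
        \<bar>s - \<sigma>\<bar> < r; \<bar>t - t0\<bar> < r; \<bar>s' - \<sigma>\<bar> < r; \<bar>t' - t0\<bar> < r\<rbrakk> \<Longrightarrow>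
        increment_le (gradients h K \<alpha> \<beta>) g s t s' t'"
    and le: "\<And>s t. \<lbrakk>s \<in> {0..1}; t \<in> T; \<bar>s - \<sigma>\<bar> < r; \<bar>t - t0\<bar> < r; \<bar>s - \<sigma>\<bar> \<ge> r / 2 \<or> \<bar>t - t0\<bar> \<ge> r / 2\<rbrakk> \<Longrightarrow>
        g s t \<le> f s t"
  shows "admissible h K T (\<lambda>s t. if \<bar>s - \<sigma>\<bar> < r \<and> \<bar>t - t0\<bar> < r then max (f s t) (g s t) else f s t)"
    (is "admissible h K T ?w")
proof (rule admissible_local[OF T])
  fix s1 t1 :: real assume st: "s1 \<in> {0..1}" "t1 \<in> T"
  show "\<exists>d>0. \<forall>\<alpha> \<beta> s t.
      0 \<le> \<alpha> \<and> \<alpha> < \<beta> \<and> \<beta> \<le> 1 \<and> s1 \<in> {\<alpha>..\<beta>} \<and> s \<in> {\<alpha>..\<beta>} \<and> t \<in> T \<and> \<bar>s - s1\<bar> < d \<and> \<bar>t - t1\<bar> < d \<longrightarrow>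
      increment_le (gradients h K \<alpha> \<beta>) ?w s1 t1 s t \<and> increment_le (gradients h K \<alpha> \<beta>) ?w s t s1 t1"
  proof (cases "\<bar>s1 - \<sigma>\<bar> < r \<and> \<bar>t1 - t0\<bar> < r")
    case True
    define d where "d = min (r - \<bar>s1 - \<sigma>\<bar>) (r - \<bar>t1 - t0\<bar>)"
    have "increment_le (gradients h K \<alpha> \<beta>) ?w s1 t1 s t \<and> increment_le (gradients h K \<alpha> \<beta>) ?w s t s1 t1"
      if "0 \<le> \<alpha>" "\<alpha> < \<beta>" "\<beta> \<le> 1" "s1 \<in> {\<alpha>..\<beta>}" "s \<in> {\<alpha>..\<beta>}" "t \<in> T" "\<bar>s - s1\<bar> < d" "\<bar>t - t1\<bar> < d" for \<alpha> \<beta> s t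
    proof -
      have b: "\<bar>s - \<sigma>\<bar> < r" "\<bar>t - t0\<bar> < r" using that unfolding d_def by auto
      have "increment_le (gradients h K \<alpha> \<beta>) (\<lambda>s t. max (f s t) (g s t)) s1 t1 s t"
        "increment_le (gradients h K \<alpha> \<beta>) (\<lambda>s t. max (f s t) (g s t)) s t s1 t1"
        using that b st True by (auto intro!: increment_le_max g admissibleD[OF f] simp del: atLeastAtMost_iff)
      then show ?thesis using b True by (simp add: increment_le_def)
    qed
    moreover have "d > 0" using True by (simp add: d_def)
    ultimately show ?thesis by blast
  next
    case False
    have w: "?w s t = f s t" if "s \<in> {0..1}" "t \<in> T" "\<bar>s - s1\<bar> < r / 2" "\<bar>t - t1\<bar> < r / 2" for s t
    proof -
      \<comment> \<open>Points within \<open>r / 2\<close> of a point outside the box cannot enter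
        the half-size box.\<close>
      have "\<bar>s - \<sigma>\<bar> \<ge> r / 2 \<or> \<bar>t - t0\<bar> \<ge> r / 2" using False that r by linarith
      then show ?thesis using le[of s t] that by auto
    qed
    have "increment_le (gradients h K \<alpha> \<beta>) ?w s1 t1 s t \<and> increment_le (gradients h K \<alpha> \<beta>) ?w s t s1 t1"
      if "0 \<le> \<alpha>" "\<alpha> < \<beta>" "\<beta> \<le> 1" "s1 \<in> {\<alpha>..\<beta>}" "s \<in> {\<alpha>..\<beta>}" "t \<in> T" "\<bar>s - s1\<bar> < r / 2" "\<bar>t - t1\<bar> < r / 2" for \<alpha> \<beta> s t
    proof -
      have "s \<in> {0..1}" using that by auto
      then have "?w s t = f s t" "?w s1 t1 = f s1 t1" using w[of s t] w[of s1 t1] st that r by auto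
      moreover have "increment_le (gradients h K \<alpha> \<beta>) f s1 t1 s t" "increment_le (gradients h K \<alpha> \<beta>) f s t s1 t1"
        using that st by (auto intro!: admissibleD[OF f] simp del: atLeastAtMost_iff)
      ultimately show ?thesis unfolding increment_le_def by presburger
    qed
    then show ?thesis using r by (intro exI[of _ "r / 2"]) auto
  qed
qed

section \<open>Lipschitz bounds on one arc\<close>

locale arc_hamiltonian =
  fixes h :: "real \<Rightarrow> real \<Rightarrow> real" and K R :: real
  assumes pos: "s \<in> {0..1::real} \<Longrightarrow> h s p > 0"
    and coercive: "s \<in> {0..1} \<Longrightarrow> \<bar>p\<bar> \<ge> R \<Longrightarrow> h s p > K"
    and cont: "continuous_on ({0..1} \<times> UNIV) (\<lambda>(s, p). h s p)"
    and convex: "s \<in> {0..1} \<Longrightarrow> convex_on UNIV (h s)"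
begin

text \<open>Positivity of \<open>h\<close> gives the upper bound on \<open>a\<close>; the floor
  \<open>-K\<close> turns \<open>a + h s p \<le> 0\<close> into \<open>h s p \<le> K\<close>, which
  coercivity excludes for large slopes.\<close>

lemma gradients_bounded:
  assumes "(a, p) \<in> gradients h K \<alpha> \<beta>" "0 \<le> \<alpha>" "\<beta> \<le> 1"
  shows "- K \<le> a" "a \<le> 0" "\<bar>p\<bar> \<le> R"
proof -
  obtain s where s: "s \<in> {\<alpha>..\<beta>}" "- K \<le> a" "a + h s p \<le> 0" using assms by (auto simp: gradients_def)
  then have "s \<in> {0..1}" using assms by auto
  with s show "- K \<le> a" "a \<le> 0" using pos[of s p] by auto
  show "\<bar>p\<bar> \<le> R"
  proof (rule ccontr)
    assume "\<not> \<bar>p\<bar> \<le> R"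
    then show False using coercive[OF \<open>s \<in> {0..1}\<close>, of p] s by auto
  qed
qed

lemma admissible_time:
  assumes "admissible h K T f" "s \<in> {0..1}" "t \<in> T" "t' \<in> T" "t \<le> t'"
  shows "f s t' \<le> f s t" "f s t - f s t' \<le> K * (t' - t)"
proof -
  have "f s t' - f s t \<le> 0"
    using assms gradients_bounded(2) by (intro increment_leD[OF admissibleD[OF assms(1), of 0 1]]) (auto intro: mult_nonpos_nonneg)
  then show "f s t' \<le> f s t" by simp
  show "f s t - f s t' \<le> K * (t' - t)"
  proof (rule increment_leD[OF admissibleD[OF assms(1), of 0 1]])
    fix a p assume "(a, p) \<in> gradients h K 0 1"
    then have "(- a) * (t' - t) \<le> K * (t' - t)" using gradients_bounded(1)[of a p 0 1] assms by (intro mult_right_mono) auto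
    then show "a * (t - t') + p * (s - s) \<le> K * (t' - t)" by (simp add: algebra_simps)
  qed (use assms in auto)
qed

lemma admissible_space:
  assumes "admissible h K T f" "s \<in> {0..1}" "s' \<in> {0..1}" "t \<in> T"
  shows "\<bar>f s t - f s' t\<bar> \<le> R * \<bar>s - s'\<bar>"
proof -
  have *: "f s t - f s' t \<le> R * \<bar>s - s'\<bar>" if "s \<in> {0..1}" "s' \<in> {0..1}" for s s'
  proof (rule increment_leD[OF admissibleD[OF assms(1), of 0 1]])
    fix a p assume "(a, p) \<in> gradients h K 0 1"
    then have "\<bar>p\<bar> * \<bar>s - s'\<bar> \<le> R * \<bar>s - s'\<bar>" using gradients_bounded(3)[of a p 0 1] by (intro mult_right_mono) auto
    then show "a * (t - t) + p * (s - s') \<le> R * \<bar>s - s'\<bar>" using abs_ge_self[of "p * (s - s')"] by (simp add: abs_mult)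
  qed (use assms that in auto)
  from *[of s s'] *[of s' s] assms show ?thesis by (auto simp: abs_minus_commute)
qed

end

section \<open>Test functions and their first-order expansions\<close>

lemma C1_near_real_derivative:
  fixes \<phi> :: "real \<Rightarrow> real"
  assumes "C1_near \<phi> t"
  shows "(\<phi> has_real_derivative deriv \<phi> t) (at t)"
proof -
  obtain D where "(\<phi> has_derivative D) (at t)" using assms unfolding C1_near_def by blast
  then obtain a where "(\<phi> has_real_derivative a) (at t)"
    by (metis differentiable_def real_differentiable_def)
  then show ?thesis by (simp add: DERIV_imp_deriv)
qed

text \<open>The partial derivatives in \<open>hj_operator\<close> are written with
  \<open>deriv\<close>, so they have to be identified with the components of the total derivative.
  One pair \<open>a\<close>, \<open>p\<close> (time slope, space slope) serves all
  Hamiltonians.\<close>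

lemma C1_near_expansion:
  fixes \<phi> :: "real \<times> real \<Rightarrow> real"
  assumes "C1_near \<phi> (s0, t0)"
  obtains a p where "\<And>h. hj_operator h \<phi> s0 t0 = a + h s0 p"
    "\<And>e. e > 0 \<Longrightarrow> \<exists>d>0. \<forall>s t. \<bar>s - s0\<bar> < d \<longrightarrow> \<bar>t - t0\<bar> < d \<longrightarrow>
       \<bar>\<phi> (s, t) - \<phi> (s0, t0) - (a * (t - t0) + p * (s - s0))\<bar> \<le> e * (\<bar>s - s0\<bar> + \<bar>t - t0\<bar>)"
proof -
  obtain D where D: "(\<phi> has_derivative D) (at (s0, t0))" using assms unfolding C1_near_def by blast
  then have lin: "bounded_linear D" by (rule has_derivative_bounded_linear)
  define a where "a = D (0, 1)"
  define p where "p = D (1, 0)"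
  have Dap: "D (x, y) = a * y + p * x" for x y
  proof -
    have "D (x, y) = D (x *\<^sub>R (1, 0) + y *\<^sub>R (0, 1))" by simp
    also have "\<dots> = x *\<^sub>R p + y *\<^sub>R a"
      unfolding a_def p_def linear_add[OF bounded_linear.linear[OF lin]] linear_cmul[OF bounded_linear.linear[OF lin]] ..
    finally show ?thesis by simp
  qed
  have "((\<lambda>\<tau>. \<phi> (s0, \<tau>)) has_derivative (\<lambda>y. D (0, y))) (at t0)"
    by (rule has_derivative_compose[OF has_derivative_Pair[OF has_derivative_const has_derivative_ident] D])
  moreover have "(\<lambda>y. D (0, y)) = (*) a" by (simp add: Dap)
  ultimately have "((\<lambda>\<tau>. \<phi> (s0, \<tau>)) has_real_derivative a) (at t0)"
    by (simp add: has_field_derivative_def)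
  then have a: "deriv (\<lambda>\<tau>. \<phi> (s0, \<tau>)) t0 = a" by (rule DERIV_imp_deriv)
  have "((\<lambda>\<sigma>. \<phi> (\<sigma>, t0)) has_derivative (\<lambda>y. D (y, 0))) (at s0)"
    by (rule has_derivative_compose[OF has_derivative_Pair[OF has_derivative_ident has_derivative_const] D])
  moreover have "(\<lambda>y. D (y, 0)) = (*) p" by (simp add: Dap)
  ultimately have "((\<lambda>\<sigma>. \<phi> (\<sigma>, t0)) has_real_derivative p) (at s0)"
    by (simp add: has_field_derivative_def)
  then have p: "deriv (\<lambda>\<sigma>. \<phi> (\<sigma>, t0)) s0 = p" by (rule DERIV_imp_deriv)
  show thesis
  proof (rule that[of a p])
    fix e :: real assume e: "e > 0"
    obtain d where d: "d > 0" "\<And>y. norm (y - (s0, t0)) < d \<Longrightarrow>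
        norm (\<phi> y - \<phi> (s0, t0) - D (y - (s0, t0))) \<le> e * norm (y - (s0, t0))"
      using D e unfolding has_derivative_at_alt by blast
    show "\<exists>d>0. \<forall>s t. \<bar>s - s0\<bar> < d \<longrightarrow> \<bar>t - t0\<bar> < d \<longrightarrow>
       \<bar>\<phi> (s, t) - \<phi> (s0, t0) - (a * (t - t0) + p * (s - s0))\<bar> \<le> e * (\<bar>s - s0\<bar> + \<bar>t - t0\<bar>)"
    proof (intro exI[of _ "d / 2"] conjI allI impI)
      fix s t assume st: "\<bar>s - s0\<bar> < d / 2" "\<bar>t - t0\<bar> < d / 2"
      have n: "norm ((s, t) - (s0, t0)) \<le> \<bar>s - s0\<bar> + \<bar>t - t0\<bar>"
        using norm_Pair_le[of "s - s0" "t - t0"] by simp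
      then have "norm ((s, t) - (s0, t0)) < d" using st by linarith
      from d(2)[OF this] have "\<bar>\<phi> (s, t) - \<phi> (s0, t0) - (a * (t - t0) + p * (s - s0))\<bar> \<le> e * norm ((s, t) - (s0, t0))"
        by (simp add: Dap)
      also have "\<dots> \<le> e * (\<bar>s - s0\<bar> + \<bar>t - t0\<bar>)" using n e by (intro mult_left_mono) auto
      finally show "\<bar>\<phi> (s, t) - \<phi> (s0, t0) - (a * (t - t0) + p * (s - s0))\<bar> \<le> e * (\<bar>s - s0\<bar> + \<bar>t - t0\<bar>)" .
    qed (use d in auto)
  qed (simp add: hj_operator_def a p)
qed

lemma eventually_at_prod_real:
  fixes s0 t0 :: real
  assumes "\<forall>\<^sub>F y in at (s0, t0) within C. P y" "P (s0, t0)"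
  obtains d where "d > 0" "\<And>s t. (s, t) \<in> C \<Longrightarrow> \<bar>s - s0\<bar> < d \<Longrightarrow> \<bar>t - t0\<bar> < d \<Longrightarrow> P (s, t)"
proof -
  obtain d where d: "d > 0" "\<And>y. y \<in> C \<Longrightarrow> y \<noteq> (s0, t0) \<and> dist y (s0, t0) < d \<Longrightarrow> P y"
    using assms(1) unfolding eventually_at by blast
  show thesis
  proof (rule that[of "d / 2"])
    fix s t assume st: "(s, t) \<in> C" "\<bar>s - s0\<bar> < d / 2" "\<bar>t - t0\<bar> < d / 2"
    have "dist (s, t) (s0, t0) < d"
      using norm_Pair_le[of "s - s0" "t - t0"] st by (simp add: dist_norm)
    then show "P (s, t)" using d(2)[of "(s, t)"] st assms(2) by auto
  qed (use d in auto)
qed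

text \<open>At first order a subtangent is an affine function which, lowered by an arbitrarily flat
  cone, stays below \<open>w\<close>. Steeper cones of the same shape later serve as
  competitors.\<close>

lemma subtangent_expansion:
  fixes w :: "real \<times> real \<Rightarrow> real"
  assumes "subtangent C w (s0, t0) \<phi>"
  obtains a p where "\<And>h. hj_operator h \<phi> s0 t0 = a + h s0 p"
    "\<And>e. e > 0 \<Longrightarrow> \<exists>d>0. \<forall>s t. (s, t) \<in> C \<longrightarrow> \<bar>s - s0\<bar> < d \<longrightarrow> \<bar>t - t0\<bar> < d \<longrightarrow>
       w (s0, t0) + a * (t - t0) + p * (s - s0) - e * (\<bar>s - s0\<bar> + \<bar>t - t0\<bar>) \<le> w (s, t)"
proof -
  obtain d where d: "d > 0" "\<And>s t. (s, t) \<in> C \<Longrightarrow> \<bar>s - s0\<bar> < d \<Longrightarrow> \<bar>t - t0\<bar> < d \<Longrightarrow>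
      w (s0, t0) - \<phi> (s0, t0) \<le> w (s, t) - \<phi> (s, t)"
    using assms eventually_at_prod_real[where ?s0.0=s0 and ?t0.0=t0 and C=C and P="\<lambda>y. w (s0, t0) - \<phi> (s0, t0) \<le> w y - \<phi> y"]
    unfolding subtangent_def by auto
  from assms have "C1_near \<phi> (s0, t0)" by (simp add: subtangent_def)
  then obtain a p where ap: "\<And>h. hj_operator h \<phi> s0 t0 = a + h s0 p"
    and ex: "\<And>e. e > 0 \<Longrightarrow> \<exists>d>0. \<forall>s t. \<bar>s - s0\<bar> < d \<longrightarrow> \<bar>t - t0\<bar> < d \<longrightarrow>
       \<bar>\<phi> (s, t) - \<phi> (s0, t0) - (a * (t - t0) + p * (s - s0))\<bar> \<le> e * (\<bar>s - s0\<bar> + \<bar>t - t0\<bar>)"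
    by (rule C1_near_expansion) blast
  show thesis
  proof (rule that[OF ap])
    fix e :: real assume "e > 0"
    then obtain d' where d': "d' > 0" "\<And>s t. \<bar>s - s0\<bar> < d' \<Longrightarrow> \<bar>t - t0\<bar> < d' \<Longrightarrow>
       \<bar>\<phi> (s, t) - \<phi> (s0, t0) - (a * (t - t0) + p * (s - s0))\<bar> \<le> e * (\<bar>s - s0\<bar> + \<bar>t - t0\<bar>)"
      using ex by blast
    show "\<exists>d>0. \<forall>s t. (s, t) \<in> C \<longrightarrow> \<bar>s - s0\<bar> < d \<longrightarrow> \<bar>t - t0\<bar> < d \<longrightarrow>
       w (s0, t0) + a * (t - t0) + p * (s - s0) - e * (\<bar>s - s0\<bar> + \<bar>t - t0\<bar>) \<le> w (s, t)"
    proof (intro exI[of _ "min d d'"] conjI allI impI)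
      fix s t assume st: "(s, t) \<in> C" "\<bar>s - s0\<bar> < min d d'" "\<bar>t - t0\<bar> < min d d'"
      then show "w (s0, t0) + a * (t - t0) + p * (s - s0) - e * (\<bar>s - s0\<bar> + \<bar>t - t0\<bar>) \<le> w (s, t)"
        using d(2)[of s t] d'(2)[of s t] by simp
    qed (use d d' in auto)
  qed
qed

lemma supertangent_expansion:
  fixes w :: "real \<times> real \<Rightarrow> real"
  assumes "supertangent C w (s0, t0) \<phi>"
  obtains a p where "\<And>h. hj_operator h \<phi> s0 t0 = a + h s0 p"
    "\<And>e. e > 0 \<Longrightarrow> \<exists>d>0. \<forall>s t. (s, t) \<in> C \<longrightarrow> \<bar>s - s0\<bar> < d \<longrightarrow> \<bar>t - t0\<bar> < d \<longrightarrow>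
       w (s, t) \<le> w (s0, t0) + a * (t - t0) + p * (s - s0) + e * (\<bar>s - s0\<bar> + \<bar>t - t0\<bar>)"
proof -
  obtain d where d: "d > 0" "\<And>s t. (s, t) \<in> C \<Longrightarrow> \<bar>s - s0\<bar> < d \<Longrightarrow> \<bar>t - t0\<bar> < d \<Longrightarrow>
      w (s0, t0) - \<phi> (s0, t0) \<ge> w (s, t) - \<phi> (s, t)"
    using assms eventually_at_prod_real[where ?s0.0=s0 and ?t0.0=t0 and C=C and P="\<lambda>y. w (s0, t0) - \<phi> (s0, t0) \<ge> w y - \<phi> y"]
    unfolding supertangent_def by auto
  from assms have "C1_near \<phi> (s0, t0)" by (simp add: supertangent_def)
  then obtain a p where ap: "\<And>h. hj_operator h \<phi> s0 t0 = a + h s0 p"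
    and ex: "\<And>e. e > 0 \<Longrightarrow> \<exists>d>0. \<forall>s t. \<bar>s - s0\<bar> < d \<longrightarrow> \<bar>t - t0\<bar> < d \<longrightarrow>
       \<bar>\<phi> (s, t) - \<phi> (s0, t0) - (a * (t - t0) + p * (s - s0))\<bar> \<le> e * (\<bar>s - s0\<bar> + \<bar>t - t0\<bar>)"
    by (rule C1_near_expansion) blast
  show thesis
  proof (rule that[OF ap])
    fix e :: real assume "e > 0"
    then obtain d' where d': "d' > 0" "\<And>s t. \<bar>s - s0\<bar> < d' \<Longrightarrow> \<bar>t - t0\<bar> < d' \<Longrightarrow>
       \<bar>\<phi> (s, t) - \<phi> (s0, t0) - (a * (t - t0) + p * (s - s0))\<bar> \<le> e * (\<bar>s - s0\<bar> + \<bar>t - t0\<bar>)"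
      using ex by blast
    show "\<exists>d>0. \<forall>s t. (s, t) \<in> C \<longrightarrow> \<bar>s - s0\<bar> < d \<longrightarrow> \<bar>t - t0\<bar> < d \<longrightarrow>
       w (s, t) \<le> w (s0, t0) + a * (t - t0) + p * (s - s0) + e * (\<bar>s - s0\<bar> + \<bar>t - t0\<bar>)"
    proof (intro exI[of _ "min d d'"] conjI allI impI)
      fix s t assume st: "(s, t) \<in> C" "\<bar>s - s0\<bar> < min d d'" "\<bar>t - t0\<bar> < min d d'"
      then show "w (s, t) \<le> w (s0, t0) + a * (t - t0) + p * (s - s0) + e * (\<bar>s - s0\<bar> + \<bar>t - t0\<bar>)"
        using d(2)[of s t] d'(2)[of s t] by simp
    qed (use d d' in auto)
  qed
qed

lemma (in arc_hamiltonian) near_in_space: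
  assumes "s0 \<in> {0..1}" "e > 0"
  obtains d where "d > 0"
    "\<And>s p p'. s \<in> {0..1} \<Longrightarrow> \<bar>s - s0\<bar> < d \<Longrightarrow> \<bar>p\<bar> \<le> B \<Longrightarrow> \<bar>p'\<bar> \<le> B \<Longrightarrow> \<bar>p' - p\<bar> < d \<Longrightarrow> \<bar>h s p' - h s0 p\<bar> < e"
proof -
  have "uniformly_continuous_on ({0..1} \<times> {-B..B}) (\<lambda>(s, p). h s p)"
    by (intro compact_uniformly_continuous compact_Times continuous_on_subset[OF cont]) auto
  then obtain d where d: "d > 0" "\<And>x y. x \<in> {0..1} \<times> {-B..B} \<Longrightarrow> y \<in> {0..1} \<times> {-B..B} \<Longrightarrow> dist y x < d \<Longrightarrow>
      dist ((\<lambda>(s, p). h s p) y) ((\<lambda>(s, p). h s p) x) < e"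
    using assms(2) unfolding uniformly_continuous_on_def by meson
  show thesis
  proof (rule that[of "d / 2"])
    fix s p p' assume a: "s \<in> {0..1}" "\<bar>s - s0\<bar> < d / 2" "\<bar>p\<bar> \<le> B" "\<bar>p'\<bar> \<le> B" "\<bar>p' - p\<bar> < d / 2"
    have "dist (s, p') (s0, p) < d"
      using norm_Pair_le[of "s - s0" "p' - p"] a by (simp add: dist_norm)
    then show "\<bar>h s p' - h s0 p\<bar> < e" using d(2)[of "(s0, p)" "(s, p')"] a assms(1) by (auto simp: dist_real_def abs_le_iff)
  qed (use d in auto)
qed

text \<open>The support-function inequality is tested in the direction \<open>(q, 1)\<close>, where \<open>q\<close> is a
  subgradient of the convex function \<open>h s\<^sub>0\<close> at the slope of the test function.\<close>

lemma (in arc_hamiltonian) admissible_imp_subsolution: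
  assumes f: "admissible h K T f" and s0: "s0 \<in> {0<..<1}" and t0: "t0 \<in> interior T"
    and sup: "supertangent UNIV (\<lambda>(s, t). f s t) (s0, t0) \<phi>"
  shows "hj_operator h \<phi> s0 t0 \<le> 0"
proof (rule ccontr)
  obtain a p where ap: "\<And>h. hj_operator h \<phi> s0 t0 = a + h s0 p"
    and ex: "\<And>e. e > 0 \<Longrightarrow> \<exists>d>0. \<forall>s t. \<bar>s - s0\<bar> < d \<longrightarrow> \<bar>t - t0\<bar> < d \<longrightarrow>
       f s t \<le> f s0 t0 + a * (t - t0) + p * (s - s0) + e * (\<bar>s - s0\<bar> + \<bar>t - t0\<bar>)"
    using supertangent_expansion[OF sup] by (auto 4 3)
  assume "\<not> ?thesis"
  then have om: "a + h s0 p > 0" using ap by simp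
  define \<omega> where "\<omega> = (a + h s0 p) / 3"
  have om: "\<omega> > 0" "a + h s0 p = 3 * \<omega>" using om by (auto simp: \<omega>_def)
  have "s0 \<in> {0..1}" using s0 by auto
  \<comment> \<open>The right derivative of \<open>h s0\<close> at \<open>p\<close>, as the infimum
    of the difference quotients.\<close>
  define q where "q = Inf ((\<lambda>t. (h s0 p - h s0 t) / (p - t)) ` ({p<..} \<inter> UNIV))"
  have q: "h s0 p' \<ge> h s0 p + q * (p' - p)" for p'
    unfolding q_def by (rule convex_le_Inf_differential[OF convex[OF \<open>s0 \<in> {0..1}\<close>]]) auto
  obtain d1 where d1: "d1 > 0"
    "\<And>s p p'. s \<in> {0..1} \<Longrightarrow> \<bar>s - s0\<bar> < d1 \<Longrightarrow> \<bar>p\<bar> \<le> R \<Longrightarrow> \<bar>p'\<bar> \<le> R \<Longrightarrow> \<bar>p' - p\<bar> < d1 \<Longrightarrow> \<bar>h s p' - h s0 p\<bar> < \<omega>"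
    using near_in_space[OF \<open>s0 \<in> {0..1}\<close> om(1)] by metis
  define \<delta> where "\<delta> = min (d1 / 2) (min s0 (1 - s0))"
  have \<delta>: "\<delta> > 0" "\<delta> < d1" "0 \<le> s0 - \<delta>" "s0 + \<delta> \<le> 1" using d1 s0 by (auto simp: \<delta>_def min_def)
  \<comment> \<open>For a gradient of the small cell,
    \<open>a' \<le> - h s p' \<le> - h s0 p' + \<omega>\<close>, and the subgradient inequality for
    \<open>q\<close> turns this into \<open>a' + p' * q \<le> m\<close>.\<close>
  define m where "m = - h s0 p + q * p + \<omega>"
  have grad: "a' + p' * q \<le> m" if g: "(a', p') \<in> gradients h K (s0 - \<delta>) (s0 + \<delta>)" for a' p'
  proof -
    obtain s where s: "s \<in> {s0 - \<delta>..s0 + \<delta>}" "a' + h s p' \<le> 0" using g by (auto simp: gradients_def)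
    have "\<bar>p'\<bar> \<le> R" using gradients_bounded(3)[OF g] \<delta> by auto
    then have "\<bar>h s p' - h s0 p'\<bar> < \<omega>" using s \<delta> d1(1) by (intro d1(2)) auto
    then show ?thesis using s(2) q[of p'] by (simp add: m_def algebra_simps)
  qed
  \<comment> \<open>Chosen so that the error of the expansion over a step \<open>\<eta>\<close> in
    direction \<open>(q, 1)\<close> is exactly \<open>\<omega> * \<eta>\<close>.\<close>
  define e where "e = \<omega> / (1 + \<bar>q\<bar>)"
  have e: "e > 0" using om by (auto simp: e_def)
  obtain d2 where d2: "d2 > 0" "\<And>s t. \<bar>s - s0\<bar> < d2 \<Longrightarrow> \<bar>t - t0\<bar> < d2 \<Longrightarrow>
       f s t \<le> f s0 t0 + a * (t - t0) + p * (s - s0) + e * (\<bar>s - s0\<bar> + \<bar>t - t0\<bar>)"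
    using ex[OF e] by blast
  obtain d3 where d3: "d3 > 0" "\<And>t. \<bar>t - t0\<bar> < d3 \<Longrightarrow> t \<in> T"
    using t0 unfolding mem_interior by (auto simp: subset_iff dist_real_def abs_minus_commute)
  define d where "d = min \<delta> (min d2 d3)"
  have d: "d > 0" "d \<le> \<delta>" "d \<le> d2" "d \<le> d3" using \<delta> d2 d3 by (auto simp: d_def)
  define \<eta> where "\<eta> = d / (2 * (1 + \<bar>q\<bar>))"
  have \<eta>: "\<eta> > 0" using d by (auto simp: \<eta>_def intro!: divide_pos_pos)
  have "\<eta> * (1 + \<bar>q\<bar>) = d / 2" by (simp add: \<eta>_def field_simps)
  then have \<eta>': "\<eta> + \<eta> * \<bar>q\<bar> = d / 2" by (simp add: algebra_simps)
  then have small: "\<eta> < d" "\<bar>\<eta> * q\<bar> < d" using \<eta> d(1)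
    by (auto simp: abs_mult intro: le_less_trans[of _ "d/2"]) 
  \<comment> \<open>The supertangent bounds the same increment from below by
    \<open>(a + p * q - \<omega>) * \<eta>\<close>. Together they give
    \<open>a + h s0 p \<le> 2 * \<omega>\<close>, against the value
    \<open>3 * \<omega>\<close>.\<close>
  have "f s0 t0 - f (s0 - \<eta> * q) (t0 - \<eta>) \<le> m * \<eta>"
  proof (rule increment_leD[OF admissibleD[OF f, of "s0 - \<delta>" "s0 + \<delta>"]])
    fix a' p' assume "(a', p') \<in> gradients h K (s0 - \<delta>) (s0 + \<delta>)"
    then have "(a' + p' * q) * \<eta> \<le> m * \<eta>" using grad \<eta> by (intro mult_right_mono) auto
    then show "a' * (t0 - (t0 - \<eta>)) + p' * (s0 - (s0 - \<eta> * q)) \<le> m * \<eta>" by (simp add: algebra_simps)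
  next
    show "s0 - \<eta> * q \<in> {s0 - \<delta>..s0 + \<delta>}" using small d by (auto simp: abs_if split: if_splits)
    show "t0 \<in> T" using d3(1) by (intro d3(2)) simp
    show "t0 - \<eta> \<in> T" using small \<eta> d by (intro d3(2)) auto
  qed (use \<delta> in auto)
  moreover have "f (s0 - \<eta> * q) (t0 - \<eta>) \<le> f s0 t0 + a * (- \<eta>) + p * (- (\<eta> * q)) + e * (\<bar>\<eta> * q\<bar> + \<eta>)"
    using d2(2)[of "s0 - \<eta> * q" "t0 - \<eta>"] small d \<eta> by auto
  moreover have "e * (\<bar>\<eta> * q\<bar> + \<eta>) = \<omega> * \<eta>"
  proof -
    have "\<bar>\<eta> * q\<bar> + \<eta> = \<eta> * (1 + \<bar>q\<bar>)" using \<eta> by (simp add: abs_mult algebra_simps)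
    moreover have "e * (1 + \<bar>q\<bar>) = \<omega>" by (simp add: e_def field_simps add_nonneg_eq_0_iff)
    ultimately show ?thesis by (simp add: mult.assoc mult.left_commute mult.commute)
  qed
  ultimately have "\<eta> * (a + h s0 p) \<le> \<eta> * (2 * \<omega>)" by (simp add: m_def algebra_simps)
  then have "a + h s0 p \<le> 2 * \<omega>" using \<eta> by simp
  then show False using om by simp
qed

section \<open>The maximal subsolution on the network\<close>

lemma finite_common_radius:
  fixes P :: "'a \<Rightarrow> real \<Rightarrow> bool"
  assumes "finite S" "\<And>x. x \<in> S \<Longrightarrow> \<exists>d>0. \<forall>e. 0 < e \<and> e \<le> d \<longrightarrow> P x e"
  obtains d where "d > 0" "\<And>x e. x \<in> S \<Longrightarrow> 0 < e \<Longrightarrow> e \<le> d \<Longrightarrow> P x e"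
proof -
  have "\<forall>x\<in>S. \<forall>\<^sub>F e in at_right 0. P x e"
    using assms(2) unfolding eventually_at_right_field
    by (metis less_imp_le)
  then have "\<forall>\<^sub>F e in at_right 0. \<forall>x\<in>S. P x e" using assms(1) by (rule eventually_ball_finite[rotated])
  then obtain b where b: "b > 0" "\<And>e. 0 < e \<Longrightarrow> e < b \<Longrightarrow> \<forall>x\<in>S. P x e"
    unfolding eventually_at_right_field by auto
  show thesis
    by (rule that[of "b / 2"]) (use b in auto)
qed

text \<open>The gluing of \<open>admissible_max_bump\<close> for the trace of a function at a
  vertex, where the slope bound \<open>c x\<close> takes the place of the gradient set.\<close>

lemma increment_bound_max_bump:
  fixes f g :: "real \<Rightarrow> real"
  assumes T: "is_interval T" and r: "r > 0"
    and f: "\<And>t t'. t \<in> T \<Longrightarrow> t' \<in> T \<Longrightarrow> t \<le> t' \<Longrightarrow> f t' - f t \<le> C * (t' - t)"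
    and g: "\<And>t t'. t \<le> t' \<Longrightarrow> \<bar>t - t0\<bar> < r \<Longrightarrow> \<bar>t' - t0\<bar> < r \<Longrightarrow> g t' - g t \<le> C * (t' - t)"
    and le: "\<And>t. \<bar>t - t0\<bar> < r \<Longrightarrow> \<bar>t - t0\<bar> \<ge> r / 2 \<Longrightarrow> g t \<le> f t"
    and t: "t \<in> T" "t' \<in> T" "t \<le> t'"
  defines "w \<equiv> \<lambda>t. if \<bar>t - t0\<bar> < r then max (f t) (g t) else f t"
  shows "w t' - w t \<le> C * (t' - t)"
proof -
  define P where "P a b \<longleftrightarrow> t \<le> a \<longrightarrow> b \<le> t' \<longrightarrow> w b - w a \<le> C * (b - a)" for a b
  have mem: "x \<in> T" if "t \<le> x" "x \<le> t'" for x using T t that unfolding is_interval_1 by blast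
  have wf: "w x = f x" if "\<bar>x - t0\<bar> \<ge> r / 2" for x using le[of x] that by (auto simp: w_def)
  have "P t t'"
  proof (rule Bolzano)
    fix a b c assume "P a b" "P b c" "a \<le> b" "b \<le> c"
    then show "P a c" unfolding P_def by (auto simp: algebra_simps)
  next
    fix x assume x: "t \<le> x" "x \<le> t'"
    show "\<exists>d>0. \<forall>a b. a \<le> x \<and> x \<le> b \<and> b - a < d \<longrightarrow> P a b"
    proof (cases "\<bar>x - t0\<bar> < r")
      case True
      have "P a b" if ab: "a \<le> x \<and> x \<le> b \<and> b - a < r - \<bar>x - t0\<bar>" for a b
        unfolding P_def
      proof (intro impI)
        assume tt: "t \<le> a" "b \<le> t'"
        have n: "\<bar>a - t0\<bar> < r" "\<bar>b - t0\<bar> < r" "a \<le> b" using ab by auto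
        have "f b - f a \<le> C * (b - a)" using ab tt by (intro f mem) auto
        moreover have "g b - g a \<le> C * (b - a)" using n by (intro g) auto
        ultimately show "w b - w a \<le> C * (b - a)" using n by (auto simp: w_def max_def)
      qed
      then show ?thesis using True by (intro exI[of _ "r - \<bar>x - t0\<bar>"]) auto
    next
      case False
      have "P a b" if ab: "a \<le> x \<and> x \<le> b \<and> b - a < r / 2" for a b
        unfolding P_def
      proof (intro impI)
        assume tt: "t \<le> a" "b \<le> t'"
        have "\<bar>a - t0\<bar> \<ge> r / 2" "\<bar>b - t0\<bar> \<ge> r / 2" using ab False by linarith+
        moreover have "f b - f a \<le> C * (b - a)" using ab tt by (intro f mem) auto
        ultimately show "w b - w a \<le> C * (b - a)" by (simp add: wf)
      qed
      then show ?thesis using r by (intro exI[of _ "r / 2"]) auto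
    qed
  qed (use t in simp)
  then show ?thesis by (simp add: P_def)
qed

text \<open>Between any two points a cone of slope \<open>e\<close> increases like a linear function
  of slope at most \<open>e\<close>; a single gradient thus bounds its increment.\<close>

lemma mult_abs_increment:
  fixes e x x' :: real
  assumes "0 \<le> e"
  obtains b where "\<bar>b\<bar> \<le> e" "e * \<bar>x\<bar> - e * \<bar>x'\<bar> = b * (x' - x)"
proof (cases "x' = x")
  case True then show ?thesis using that[of 0] assms by simp
next
  case False
  define b where "b = (e * \<bar>x\<bar> - e * \<bar>x'\<bar>) / (x' - x)"
  have "\<bar>e * \<bar>x\<bar> - e * \<bar>x'\<bar>\<bar> = e * \<bar>\<bar>x\<bar> - \<bar>x'\<bar>\<bar>"
    using assms by (simp add: right_diff_distrib[symmetric] abs_mult)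
  also have "\<dots> \<le> e * \<bar>x' - x\<bar>" using assms by (intro mult_left_mono) auto
  finally have "\<bar>b\<bar> \<le> e" using False by (simp add: b_def divide_le_eq)
  moreover have "e * \<bar>x\<bar> - e * \<bar>x'\<bar> = b * (x' - x)" using False by (simp add: b_def)
  ultimately show ?thesis by (rule that)
qed

section \<open>Geometry of the network and the standing assumptions\<close>

lemma arc_of_network:
  assumes "network E" "\<gamma> \<in> E"
  shows "arc \<gamma>"
proof -
  have "simple_path \<gamma>" "\<gamma> 0 \<noteq> \<gamma> 1" using assms by (auto simp: network_def regular_curve_def)
  then show ?thesis by (simp add: arc_simple_path pathstart_def pathfinish_def)
qed

lemma reversepath_apply: "reversepath \<gamma> s = \<gamma> (1 - s)"
  by (simp add: reversepath_def)

text \<open>An injective continuous map on a compact interval has a continuous inverse, which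
  settles each arc; finitely many closed pieces are then glued.\<close>

lemma continuous_on_support:
  fixes v :: "real ^ 'n \<Rightarrow> real \<Rightarrow> real"
  assumes N: "network E"
    and v: "\<And>\<gamma>. \<gamma> \<in> E \<Longrightarrow> continuous_on ({0..1} \<times> T) (\<lambda>(s, t). v (\<gamma> s) t)"
  shows "continuous_on (support E \<times> T) (\<lambda>(x, t). v x t)"
proof -
  have piece: "continuous_on (\<gamma> ` {0..1} \<times> T) (\<lambda>(x, t). v x t)" if \<gamma>: "\<gamma> \<in> E" for \<gamma>
  proof -
    from arc_of_network[OF N \<gamma>] have c: "continuous_on {0..1} \<gamma>" "inj_on \<gamma> {0..1}"
      by (auto simp: arc_def path_def)
    define \<eta> where "\<eta> = the_inv_into {0..1} \<gamma>"
    have inv: "\<eta> (\<gamma> s) = s" if "s \<in> {0..1}" for s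
      unfolding \<eta>_def by (rule the_inv_into_f_f[OF c(2) that])
    have "continuous_on (\<gamma> ` {0..1}) \<eta>"
      by (rule continuous_on_inv[OF c(1)]) (auto simp: inv)
    then have "continuous_on (\<gamma> ` {0..1} \<times> T) (\<lambda>z. \<eta> (fst z))"
      by (rule continuous_on_compose2) (auto intro: continuous_on_fst continuous_on_id)
    then have "continuous_on (\<gamma> ` {0..1} \<times> T) (\<lambda>z. (\<eta> (fst z), snd z))"
      by (intro continuous_on_Pair continuous_on_snd continuous_on_id)
    then have "continuous_on (\<gamma> ` {0..1} \<times> T) (\<lambda>z. (\<lambda>(s, t). v (\<gamma> s) t) (\<eta> (fst z), snd z))"
      by (rule continuous_on_compose2[OF v[OF \<gamma>]]) (auto simp: inv)
    then show ?thesis by (rule continuous_on_eq) (auto simp: inv)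
  qed
  have "finite E" using N by (simp add: network_def)
  have "continuous_on ((\<Union>\<gamma>\<in>F. \<gamma> ` {0..1}) \<times> T) (\<lambda>(x, t). v x t)" if "F \<subseteq> E" for F
    using finite_subset[OF that \<open>finite E\<close>] that
  proof (induction F rule: finite_induct)
    case (insert \<gamma> F)
    have comp: "compact (\<gamma>' ` {0..1})" if "\<gamma>' \<in> E" for \<gamma>'
      using arc_of_network[OF N that] by (intro compact_continuous_image) (auto simp: arc_def path_def)
    let ?A = "\<gamma> ` {0..1}" and ?B = "\<Union>\<gamma>\<in>F. \<gamma> ` {0..1}"
    have clA: "closed ?A" using comp insert.prems by (auto intro: compact_imp_closed)
    have clB: "closed ?B" using comp insert by (intro closed_UN) (auto intro: compact_imp_closed)
    \<comment> \<open>\<open>T\<close> need not be closed, but within the union the piece is cut out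
      by the closed set \<open>C \<times> UNIV\<close>.\<close>
    have *: "closedin (top_of_set (?A \<times> T \<union> ?B \<times> T)) (C \<times> T)" if "closed C" "C \<subseteq> ?A \<union> ?B" for C
    proof -
      have "C \<times> T = (?A \<times> T \<union> ?B \<times> T) \<inter> (C \<times> UNIV)" using that by auto
      moreover have "closed (C \<times> (UNIV :: real set))" using that by (intro closed_Times) auto
      ultimately show ?thesis by (metis closedin_closed_Int)
    qed
    have "continuous_on (?A \<times> T \<union> ?B \<times> T) (\<lambda>(x, t). v x t)"
      using insert clA clB by (intro continuous_on_Un_local * piece) auto
    moreover have "(\<Union>\<gamma>\<in>insert \<gamma> F. \<gamma> ` {0..1}) \<times> T = ?A \<times> T \<union> ?B \<times> T" by auto
    ultimately show ?case by simp
  qed simp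
  then show ?thesis unfolding support_def by blast
qed

text \<open>\<open>M\<close> will be \<open>M0\<close>, represented by the estimates
  \<open>c_bound\<close> and \<open>g_bound\<close>. \<open>R\<close> will bound the space slopes of
  all members of the class, on all arcs at once.\<close>

locale hj_network =
  fixes E :: "(real \<Rightarrow> real ^ 'n) set"
    and H :: "(real \<Rightarrow> real ^ 'n) \<Rightarrow> real \<Rightarrow> real \<Rightarrow> real"
    and c g :: "real ^ 'n \<Rightarrow> real"
    and T0 :: real and T1 :: ereal and M R :: real
  assumes T01: "ereal T0 < T1"
    and network: "network E"
    and ham: "hamiltonians E H"
    and flux: "flux_limiter E H c"
    and g_lip: "lipschitz_space E g"
    and nonempty: "E \<noteq> {}"
    and c_bound: "x \<in> vertices E \<Longrightarrow> \<bar>c x\<bar> \<le> M"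
    and g_bound: "\<gamma> \<in> E \<Longrightarrow> AE s in lebesgue. 0 < s \<and> s < 1 \<longrightarrow> H \<gamma> s (deriv (g \<circ> \<gamma>) s) \<le> M"
    and R: "\<gamma> \<in> E \<Longrightarrow> s \<in> {0..1} \<Longrightarrow> \<bar>p\<bar> \<ge> R \<Longrightarrow> H \<gamma> s p > M + 1"
    and R_nonneg: "R \<ge> 0"
begin

text \<open>Any bound larger than \<open>M\<close> would do: the strict inequality leaves room to perturb time slopes that
  are at least \<open>-M\<close>.\<close>
definition K :: real where "K = M + 1"

abbreviation T :: "real set" where "T \<equiv> time_halfopen T0 T1"

lemma finite_E: "finite E" using network by (simp add: network_def)

lemma reverse_E: "\<gamma> \<in> E \<Longrightarrow> reversepath \<gamma> \<in> E" using network by (simp add: network_def)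

lemma disjoint_E:
  "\<gamma> \<in> E \<Longrightarrow> \<gamma>' \<in> E \<Longrightarrow> \<gamma>' \<noteq> \<gamma> \<Longrightarrow> \<gamma>' \<noteq> reversepath \<gamma> \<Longrightarrow> s \<in> {0<..<1} \<Longrightarrow> s' \<in> {0..1} \<Longrightarrow> \<gamma> s \<noteq> \<gamma>' s'"
  using network unfolding network_def by (blast intro: imageI)

lemma inj_E: "\<gamma> \<in> E \<Longrightarrow> s \<in> {0..1} \<Longrightarrow> s' \<in> {0..1} \<Longrightarrow> \<gamma> s = \<gamma> s' \<Longrightarrow> s = s'"
  using arc_of_network[OF network, of \<gamma>] by (auto simp: arc_def inj_on_def)

lemma M_nonneg: "M \<ge> 0"
proof -
  obtain \<gamma> where "\<gamma> \<in> E" using nonempty by blast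
  then have "\<gamma> 0 \<in> vertices E" by (auto simp: vertices_def)
  from c_bound[OF this] show ?thesis by simp
qed

lemma arc_ham: "\<gamma> \<in> E \<Longrightarrow> arc_hamiltonian (H \<gamma>) K R"
  using ham R R_nonneg M_nonneg unfolding hamiltonians_def K_def
  by unfold_locales auto

lemma interval_T: "is_interval T"
  unfolding is_interval_1 time_halfopen_def
  by (auto intro: order.strict_trans1[of "ereal _" "ereal _" T1])

lemma T0_in_T: "T0 \<in> T" using T01 by (simp add: time_halfopen_def)

lemma T_ge: "t \<in> T \<Longrightarrow> T0 \<le> t" by (simp add: time_halfopen_def)

lemma T_down: "t \<in> T \<Longrightarrow> T0 \<le> t' \<Longrightarrow> t' \<le> t \<Longrightarrow> t' \<in> T"
  using interval_T T0_in_T unfolding is_interval_1 by blast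

lemma open_time: "open (time_open T0 T1)"
proof -
  have "time_open T0 T1 = {T0<..} \<inter> {t. ereal t < T1}" by (auto simp: time_open_def)
  moreover have "open {t. ereal t < T1}" by (cases T1) (auto simp: lessThan_def[symmetric])
  ultimately show ?thesis by (metis open_Int open_greaterThan)
qed

lemma time_open_subset: "time_open T0 T1 \<subseteq> T"
  by (auto simp: time_open_def time_halfopen_def)

lemma time_openE:
  assumes "t0 \<in> time_open T0 T1"
  obtains d where "d > 0" "\<And>t. \<bar>t - t0\<bar> < d \<Longrightarrow> t \<in> time_open T0 T1"
  using open_time assms unfolding open_dist by (metis dist_real_def)

text \<open>The vertex condition is imposed on increments and not through supertangents, because
  increment bounds survive suprema, time shifts and gluing.\<close>

definition subsolutions :: "(real ^ 'n \<Rightarrow> real \<Rightarrow> real) set" where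
  "subsolutions = {w.
     (\<forall>\<gamma>\<in>E. admissible (H \<gamma>) K T (\<lambda>s t. w (\<gamma> s) t)) \<and>
     (\<forall>x\<in>vertices E. \<forall>t\<in>T. \<forall>t'\<in>T. t \<le> t' \<longrightarrow> w x t' - w x t \<le> c x * (t' - t)) \<and>
     (\<forall>y\<in>support E. w y T0 \<le> g y)}"

definition barrier :: "real ^ 'n \<Rightarrow> real \<Rightarrow> real" where
  "barrier y t = g y - M * (t - T0)"

text \<open>The gradient of the barrier is \<open>(- M, g')\<close>, admissible at almost every
  \<open>s\<close> by \<open>g_bound\<close>; integration in \<open>s\<close> gives the increment
  bound.\<close>

lemma barrier_admissible:
  assumes \<gamma>: "\<gamma> \<in> E"
  shows "admissible (H \<gamma>) K T (\<lambda>s t. barrier (\<gamma> s) t)"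
  unfolding admissible_def
proof (intro allI impI ballI increment_leI)
  fix \<alpha> \<beta> s s' t t' m
  assume ab: "0 \<le> \<alpha>" "\<alpha> < \<beta>" "\<beta> \<le> 1" and s: "s \<in> {\<alpha>..\<beta>}" "s' \<in> {\<alpha>..\<beta>}" and t: "t \<in> T" "t' \<in> T"
    and m: "\<And>a p. (a, p) \<in> gradients (H \<gamma>) K \<alpha> \<beta> \<Longrightarrow> a * (t' - t) + p * (s' - s) \<le> m"
  obtain L where L: "L-lipschitz_on {0..1} (g \<circ> \<gamma>)" using g_lip \<gamma> by (auto simp: lipschitz_space_def)
  obtain G where G_lip: "L-lipschitz_on UNIV G" and G: "\<And>x. x \<in> {0..1} \<Longrightarrow> G x = (g \<circ> \<gamma>) x"
    and G_deriv: "\<And>x. 0 < x \<Longrightarrow> x < 1 \<Longrightarrow> deriv G x = deriv (g \<circ> \<gamma>) x"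
    using lipschitz_clamp[OF L] by metis
  have G_eq: "G x = g (\<gamma> x)" if "x \<in> {\<alpha>..\<beta>}" for x using that ab G[of x] by auto
  \<comment> \<open>What \<open>m\<close> leaves for the spatial part when the time slope is
    \<open>- M\<close>.\<close>
  define n where "n = m + M * (t' - t)"
  have ae: "AE x in lebesgue. \<alpha> < x \<and> x < \<beta> \<longrightarrow> (s' - s) * deriv G x \<le> n"
    using g_bound[OF \<gamma>]
  proof eventually_elim
    fix x assume x: "0 < x \<and> x < 1 \<longrightarrow> H \<gamma> x (deriv (g \<circ> \<gamma>) x) \<le> M"
    show "\<alpha> < x \<and> x < \<beta> \<longrightarrow> (s' - s) * deriv G x \<le> n"
    proof
      assume x': "\<alpha> < x \<and> x < \<beta>"
      then have "(- M, deriv G x) \<in> gradients (H \<gamma>) K \<alpha> \<beta>"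
        using x ab by (auto simp: gradients_def K_def G_deriv intro!: bexI[of _ x])
      from m[OF this] show "(s' - s) * deriv G x \<le> n" by (simp add: n_def algebra_simps)
    qed
  qed
  have "g (\<gamma> s') - g (\<gamma> s) \<le> n"
  proof (cases s s' rule: linorder_cases)
    case less
    have "(s' - s) * (G s' - G s) \<le> n * (s' - s)"
      by (rule lipschitz_increment_le[OF G_lip]) (use less s ae in \<open>auto elim: eventually_mono\<close>)
    then show ?thesis using less s by (simp add: G_eq mult.commute)
  next
    case equal
    \<comment> \<open>Without displacement the claim is \<open>0 \<le> n\<close>. It rests on the
      existence of an admissible gradient, which the almost-everywhere bound supplies because the
      cell has positive length.\<close>
    have "0 * (G \<beta> - G \<alpha>) \<le> n * (\<beta> - \<alpha>)"
      by (rule lipschitz_increment_le[OF G_lip]) (use ae ab equal in auto)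
    then show ?thesis using ab equal by (simp add: zero_le_mult_iff)
  next
    case greater
    have "(s' - s) * (G s - G s') \<le> n * (s - s')"
      by (rule lipschitz_increment_le[OF G_lip]) (use greater s ae in \<open>auto elim: eventually_mono\<close>)
    then have "(s - s') * (G s' - G s) \<le> (s - s') * n" by (simp add: algebra_simps)
    then show ?thesis using greater s by (simp add: G_eq)
  qed
  then show "barrier (\<gamma> s') t' - barrier (\<gamma> s) t \<le> m"
    by (simp add: barrier_def n_def algebra_simps)
qed

lemma barrier_slope:
  assumes "x \<in> vertices E" "t \<le> t'"
  shows "barrier x t' - barrier x t \<le> c x * (t' - t)"
proof -
  have "(- M) * (t' - t) \<le> c x * (t' - t)"
    using c_bound[OF assms(1)] assms(2) by (intro mult_right_mono) auto
  then show ?thesis by (simp add: barrier_def algebra_simps)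
qed

lemma barrier_in: "barrier \<in> subsolutions"
  unfolding subsolutions_def
  by (auto simp: barrier_admissible barrier_slope) (simp add: barrier_def)

section \<open>The supremum of the class\<close>

lemma supportE:
  assumes "y \<in> support E"
  obtains \<gamma> s where "\<gamma> \<in> E" "s \<in> {0..1}" "y = \<gamma> s"
  using assms by (auto simp: support_def)

lemma arc_in_support: "\<gamma> \<in> E \<Longrightarrow> s \<in> {0..1} \<Longrightarrow> \<gamma> s \<in> support E"
  unfolding support_def by blast

lemma vertex_support: "x \<in> vertices E \<Longrightarrow> x \<in> support E"
  by (auto simp: vertices_def intro: arc_in_support)

lemma subsolutions_time:
  assumes "w \<in> subsolutions" "y \<in> support E" "t \<in> T" "t' \<in> T" "t \<le> t'"
  shows "w y t' \<le> w y t" "w y t - w y t' \<le> K * (t' - t)"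
proof -
  obtain \<gamma> s where y: "\<gamma> \<in> E" "s \<in> {0..1}" "y = \<gamma> s" using assms(2) by (rule supportE)
  interpret arc_hamiltonian "H \<gamma>" K R by (rule arc_ham[OF y(1)])
  have "admissible (H \<gamma>) K T (\<lambda>s t. w (\<gamma> s) t)" using assms(1) y(1) by (auto simp: subsolutions_def)
  from admissible_time[OF this y(2) assms(3-5)] y(3) show "w y t' \<le> w y t" "w y t - w y t' \<le> K * (t' - t)" by auto
qed

lemma subsolutions_le_g:
  assumes "w \<in> subsolutions" "y \<in> support E" "t \<in> T"
  shows "w y t \<le> g y"
proof -
  have "w y t \<le> w y T0" by (rule subsolutions_time(1)[OF assms(1,2) T0_in_T assms(3) T_ge[OF assms(3)]])
  also have "\<dots> \<le> g y" using assms by (auto simp: subsolutions_def)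
  finally show ?thesis .
qed

definition perron :: "real ^ 'n \<Rightarrow> real \<Rightarrow> real" where
  "perron y t = (SUP w\<in>subsolutions. w y t)"

lemma perron_upper:
  assumes "w \<in> subsolutions" "y \<in> support E" "t \<in> T"
  shows "w y t \<le> perron y t"
  unfolding perron_def using assms subsolutions_le_g
  by (intro cSUP_upper) (auto intro!: bdd_aboveI2[where M="g y"])

lemma perron_least:
  assumes "\<And>w. w \<in> subsolutions \<Longrightarrow> w y t \<le> B"
  shows "perron y t \<le> B"
  unfolding perron_def using assms barrier_in by (intro cSUP_least) auto

text \<open>A bound that is the same for all competitors passes to the supremum; the conditions on
  arcs and at vertices both have this form.\<close>

lemma perron_increment:
  assumes "y \<in> support E" "t \<in> T" "\<And>w. w \<in> subsolutions \<Longrightarrow> w y' t' - w y t \<le> B"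
  shows "perron y' t' - perron y t \<le> B"
proof -
  have "perron y' t' \<le> perron y t + B"
  proof (rule perron_least)
    fix w assume w: "w \<in> subsolutions"
    show "w y' t' \<le> perron y t + B" using assms(3)[OF w] perron_upper[OF w assms(1,2)] by simp
  qed
  then show ?thesis by simp
qed

lemma perron_in: "perron \<in> subsolutions"
  unfolding subsolutions_def
proof (intro CollectI conjI ballI impI)
  fix \<gamma> assume \<gamma>: "\<gamma> \<in> E"
  show "admissible (H \<gamma>) K T (\<lambda>s t. perron (\<gamma> s) t)"
    unfolding admissible_def
  proof (intro allI impI ballI increment_leI)
    fix \<alpha> \<beta> s s' t t' m
    assume ab: "0 \<le> \<alpha>" "\<alpha> < \<beta>" "\<beta> \<le> 1" and s: "s \<in> {\<alpha>..\<beta>}" "s' \<in> {\<alpha>..\<beta>}" and t: "t \<in> T" "t' \<in> T"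
      and m: "\<And>a p. (a, p) \<in> gradients (H \<gamma>) K \<alpha> \<beta> \<Longrightarrow> a * (t' - t) + p * (s' - s) \<le> m"
    show "perron (\<gamma> s') t' - perron (\<gamma> s) t \<le> m"
    proof (rule perron_increment)
      show "\<gamma> s \<in> support E" using \<gamma> s ab by (intro arc_in_support) auto
      fix w assume "w \<in> subsolutions"
      then have "admissible (H \<gamma>) K T (\<lambda>s t. w (\<gamma> s) t)" using \<gamma> by (auto simp: subsolutions_def)
      from increment_leD[OF admissibleD[OF this ab s t] m] show "w (\<gamma> s') t' - w (\<gamma> s) t \<le> m" .
    qed (use t in auto)
  qed
next
  fix x t t' assume "x \<in> vertices E" "t \<in> T" "t' \<in> T" "t \<le> t'"
  then show "perron x t' - perron x t \<le> c x * (t' - t)"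
    by (intro perron_increment vertex_support) (auto simp: subsolutions_def)
next
  fix y assume "y \<in> support E"
  then show "perron y T0 \<le> g y" using subsolutions_le_g T0_in_T by (intro perron_least) auto
qed

lemma perron_initial: "y \<in> support E \<Longrightarrow> perron y T0 = g y"
  using perron_upper[OF barrier_in _ T0_in_T, of y] perron_in
  by (auto simp: subsolutions_def barrier_def intro: antisym)

text \<open>Translating a subsolution in time and filling the gap with the barrier shows that the maximal
  subsolution decreases at rate at most \<open>M\<close>, although its competitors may decrease at rate \<open>K\<close>.\<close>

definition translate :: "real \<Rightarrow> (real ^ 'n \<Rightarrow> real \<Rightarrow> real) \<Rightarrow> real ^ 'n \<Rightarrow> real \<Rightarrow> real" where
  "translate \<eta> w y t =
     (if t < T0 + \<eta> then barrier y t else max (barrier y t) (w y (t - \<eta>) - M * \<eta>))"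

lemma translate_in:
  assumes w: "w \<in> subsolutions" and \<eta>: "\<eta> > 0"
  shows "translate \<eta> w \<in> subsolutions"
  unfolding subsolutions_def
proof (intro CollectI conjI ballI impI)
  \<comment> \<open>At the seam \<open>t = T0 + \<eta>\<close> the shifted function has the value
    \<open>w y T0 - M * \<eta>\<close>, at most the barrier's value \<open>g y - M * \<eta>\<close>;
    hence both branches agree there.\<close>
  have at_start: "translate \<eta> w y t = barrier y t" if "y \<in> support E" "t \<le> T0 + \<eta>" for y t
    using w that by (auto simp: translate_def subsolutions_def barrier_def max_def)
  have shift: "t - \<eta> \<in> T" if "t \<in> T" "T0 + \<eta> \<le> t" for t using that \<eta> T_down[of t "t - \<eta>"] by auto
  {
    fix \<gamma> assume \<gamma>: "\<gamma> \<in> E"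
    have w\<gamma>: "admissible (H \<gamma>) K T (\<lambda>s t. w (\<gamma> s) t)" using w \<gamma> by (auto simp: subsolutions_def)
    have supp: "\<gamma> s \<in> support E" if "0 \<le> \<alpha>" "\<beta> \<le> 1" "s \<in> {\<alpha>..\<beta>}" for \<alpha> \<beta> s
      using \<gamma> that by (intro arc_in_support) auto
    have early: "increment_le (gradients (H \<gamma>) K \<alpha> \<beta>) (\<lambda>s. translate \<eta> w (\<gamma> s)) s t s' t'"
      if "0 \<le> \<alpha>" "\<alpha> < \<beta>" "\<beta> \<le> 1" "s \<in> {\<alpha>..\<beta>}" "s' \<in> {\<alpha>..\<beta>}" "t \<in> T" "t' \<in> T" "t \<le> T0 + \<eta>" "t' \<le> T0 + \<eta>"
      for \<alpha> \<beta> s t s' t'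
      using admissibleD[OF barrier_admissible[OF \<gamma>] that(1-7)] that
        at_start[OF supp[OF that(1,3,4)] that(8)] at_start[OF supp[OF that(1,3,5)] that(9)]
      by (simp add: increment_le_def)
    have late: "increment_le (gradients (H \<gamma>) K \<alpha> \<beta>) (\<lambda>s. translate \<eta> w (\<gamma> s)) s t s' t'"
      if h: "0 \<le> \<alpha>" "\<alpha> < \<beta>" "\<beta> \<le> 1" "s \<in> {\<alpha>..\<beta>}" "s' \<in> {\<alpha>..\<beta>}" "t \<in> T" "t' \<in> T" and g: "T0 + \<eta> \<le> t" "T0 + \<eta> \<le> t'"
      for \<alpha> \<beta> s t s' t'
    proof -
      \<comment> \<open>The Hamiltonians do not depend on time, so increment bounds survive the
        shift; the constant \<open>M * \<eta>\<close> cancels in differences.\<close>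
      have "increment_le (gradients (H \<gamma>) K \<alpha> \<beta>) (\<lambda>s t. w (\<gamma> s) t) s (t - \<eta>) s' (t' - \<eta>)"
        using h g by (intro admissibleD[OF w\<gamma>] shift) auto
      then have "increment_le (gradients (H \<gamma>) K \<alpha> \<beta>) (\<lambda>s t. w (\<gamma> s) (t - \<eta>) - M * \<eta>) s t s' t'"
        by (simp add: increment_le_def)
      from increment_le_max[OF admissibleD[OF barrier_admissible[OF \<gamma>] h] this]
      show ?thesis using g by (simp add: increment_le_def translate_def)
    qed
    show "admissible (H \<gamma>) K T (\<lambda>s t. translate \<eta> w (\<gamma> s) t)"
    proof (rule admissible_local[OF interval_T])
      fix s0 t0 :: real assume st: "s0 \<in> {0..1}" "t0 \<in> T"
      \<comment> \<open>On the seam both formulas are valid, so any radius works; elsewhere the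
        distance to the seam keeps both times on the same side.\<close>
      define d where "d = (if t0 = T0 + \<eta> then 1 else \<bar>t0 - (T0 + \<eta>)\<bar>)"
      have same_side: "t0 \<le> T0 + \<eta> \<and> t \<le> T0 + \<eta> \<or> T0 + \<eta> \<le> t0 \<and> T0 + \<eta> \<le> t" if "\<bar>t - t0\<bar> < d" for t
        using that by (auto simp: d_def split: if_splits)
      show "\<exists>d>0. \<forall>\<alpha> \<beta> s t. 0 \<le> \<alpha> \<and> \<alpha> < \<beta> \<and> \<beta> \<le> 1 \<and> s0 \<in> {\<alpha>..\<beta>} \<and> s \<in> {\<alpha>..\<beta>} \<and> t \<in> T \<and>
          \<bar>s - s0\<bar> < d \<and> \<bar>t - t0\<bar> < d \<longrightarrow>
          increment_le (gradients (H \<gamma>) K \<alpha> \<beta>) (\<lambda>s. translate \<eta> w (\<gamma> s)) s0 t0 s t \<and>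
          increment_le (gradients (H \<gamma>) K \<alpha> \<beta>) (\<lambda>s. translate \<eta> w (\<gamma> s)) s t s0 t0"
      proof (intro exI[of _ d] conjI[of "d > 0"] allI impI)
        fix \<alpha> \<beta> s t
        assume h: "0 \<le> \<alpha> \<and> \<alpha> < \<beta> \<and> \<beta> \<le> 1 \<and> s0 \<in> {\<alpha>..\<beta>} \<and> s \<in> {\<alpha>..\<beta>} \<and> t \<in> T \<and> \<bar>s - s0\<bar> < d \<and> \<bar>t - t0\<bar> < d"
        then have "\<bar>t - t0\<bar> < d" by blast
        from same_side[OF this]
        show "increment_le (gradients (H \<gamma>) K \<alpha> \<beta>) (\<lambda>s. translate \<eta> w (\<gamma> s)) s0 t0 s t \<and>
          increment_le (gradients (H \<gamma>) K \<alpha> \<beta>) (\<lambda>s. translate \<eta> w (\<gamma> s)) s t s0 t0"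
        proof
          assume "t0 \<le> T0 + \<eta> \<and> t \<le> T0 + \<eta>"
          then show ?thesis using h st(2) by (intro conjI early) auto
        next
          assume "T0 + \<eta> \<le> t0 \<and> T0 + \<eta> \<le> t"
          then show ?thesis using h st(2) by (intro conjI late) auto
        qed
      qed (auto simp: d_def)
    qed
  next
    fix x t t' assume x: "x \<in> vertices E" and t: "t \<in> T" "t' \<in> T" "t \<le> t'"
    have wx: "w x b - w x a \<le> c x * (b - a)" if "a \<in> T" "b \<in> T" "a \<le> b" for a b
      using w x that by (auto simp: subsolutions_def)
    have late: "translate \<eta> w x b - translate \<eta> w x a \<le> c x * (b - a)"
      if h: "a \<in> T" "b \<in> T" "a \<le> b" "T0 + \<eta> \<le> a" for a b
      using barrier_slope[OF x h(3)] wx[OF shift[OF h(1)] shift[OF h(2)]] h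
      by (auto simp: translate_def max_def)
    show "translate \<eta> w x t' - translate \<eta> w x t \<le> c x * (t' - t)"
    proof (cases "T0 + \<eta> \<le> t \<or> t' \<le> T0 + \<eta>")
      case True
      then show ?thesis
        using late[OF t] barrier_slope[OF x t(3)] t
          at_start[OF vertex_support[OF x], of t] at_start[OF vertex_support[OF x], of t'] by auto
    next
      case False
      then have "T0 + \<eta> \<in> T" using t \<eta> T_down[of t' "T0 + \<eta>"] by auto
      then have "translate \<eta> w x t' - translate \<eta> w x (T0 + \<eta>) \<le> c x * (t' - (T0 + \<eta>))"
        using t False by (intro late) auto
      moreover have "translate \<eta> w x (T0 + \<eta>) - translate \<eta> w x t \<le> c x * (T0 + \<eta> - t)"
        using barrier_slope[OF x, of t "T0 + \<eta>"] False
          at_start[OF vertex_support[OF x], of t] at_start[OF vertex_support[OF x], of "T0 + \<eta>"] by auto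
      ultimately show ?thesis by (simp add: algebra_simps)
    qed
  next
    fix y assume "y \<in> support E"
    then show "translate \<eta> w y T0 \<le> g y" using at_start[of y T0] \<eta> by (simp add: barrier_def)
  }
qed

text \<open>The shift by \<open>t' - t\<close> moves the value at \<open>t\<close>, lowered by
  \<open>M * (t' - t)\<close>, to the time \<open>t'\<close>; maximality does the rest.\<close>

lemma perron_time:
  assumes y: "y \<in> support E" and t: "t \<in> T" "t' \<in> T" "t \<le> t'"
  shows "perron y t' \<le> perron y t" "perron y t - perron y t' \<le> M * (t' - t)"
proof -
  show "perron y t' \<le> perron y t" by (rule subsolutions_time(1)[OF perron_in y t])
  show "perron y t - perron y t' \<le> M * (t' - t)"
  proof (cases "t = t'")
    case False
    then have "translate (t' - t) perron \<in> subsolutions" using t by (intro translate_in perron_in) auto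
    from perron_upper[OF this y t(2)] show ?thesis using T_ge[OF t(1)] t by (auto simp: translate_def)
  qed simp
qed

section \<open>Regularity and the subsolution property\<close>

lemma perron_lipschitz_time:
  assumes y: "y \<in> support E"
  shows "M-lipschitz_on T (perron y)"
proof (rule lipschitz_onI)
  fix t t' assume "t \<in> T" "t' \<in> T"
  then show "dist (perron y t) (perron y t') \<le> M * dist t t'"
    using perron_time[OF y, of t t'] perron_time[OF y, of t' t]
    by (cases "t \<le> t'") (auto simp: dist_real_def abs_if)
qed (rule M_nonneg)

lemma perron_space:
  assumes "\<gamma> \<in> E" "s \<in> {0..1}" "s' \<in> {0..1}" "t \<in> T"
  shows "\<bar>perron (\<gamma> s) t - perron (\<gamma> s') t\<bar> \<le> R * \<bar>s - s'\<bar>"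
proof -
  have "admissible (H \<gamma>) K T (\<lambda>s t. perron (\<gamma> s) t)" using perron_in assms(1) by (auto simp: subsolutions_def)
  from arc_hamiltonian.admissible_space[OF arc_ham[OF assms(1)] this assms(2-4)] show ?thesis .
qed

lemma perron_lipschitz_arc:
  assumes \<gamma>: "\<gamma> \<in> E"
  shows "(M + R)-lipschitz_on ({0..1} \<times> T) (\<lambda>(s, t). perron (\<gamma> s) t)"
proof (rule lipschitz_onI)
  fix x y :: "real \<times> real" assume "x \<in> {0..1} \<times> T" "y \<in> {0..1} \<times> T"
  then obtain s t s' t' where xy: "x = (s, t)" "y = (s', t')" "s \<in> {0..1}" "t \<in> T" "s' \<in> {0..1}" "t' \<in> T" by auto
  have "dist (perron (\<gamma> s) t) (perron (\<gamma> s') t') \<le>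
      dist (perron (\<gamma> s) t) (perron (\<gamma> s) t') + dist (perron (\<gamma> s) t') (perron (\<gamma> s') t')"
    by (rule dist_triangle)
  also have "\<dots> \<le> M * dist t t' + R * dist s s'"
    using lipschitz_onD[OF perron_lipschitz_time[OF arc_in_support[OF \<gamma> xy(3)]] xy(4,6)]
      perron_space[OF \<gamma> xy(3,5,6)] by (simp add: dist_real_def)
  also have "\<dots> \<le> M * dist x y + R * dist x y"
    using M_nonneg R_nonneg dist_fst_le[of x y] dist_snd_le[of x y] xy
    by (intro add_mono mult_left_mono) auto
  finally show "dist (case x of (s, t) \<Rightarrow> perron (\<gamma> s) t) (case y of (s, t) \<Rightarrow> perron (\<gamma> s) t) \<le> (M + R) * dist x y"
    using xy by (simp add: algebra_simps)
qed (use M_nonneg R_nonneg in auto)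

lemma perron_continuous: "continuous_on (support E \<times> T) (\<lambda>(x, t). perron x t)"
  using lipschitz_on_continuous_on[OF perron_lipschitz_arc] by (rule continuous_on_support[OF network])

lemma perron_lipschitz: "lipschitz_spacetime E T0 T1 perron"
  unfolding lipschitz_spacetime_def using perron_continuous perron_lipschitz_arc by blast

lemma perron_subsolution: "hj_subsolution E H c T0 T1 perron"
  unfolding hj_subsolution_def arc_subsolution_def
proof (intro conjI ballI allI impI)
  show "continuous_on (support E \<times> T) (\<lambda>(x, t). perron x t)" by (rule perron_continuous)
next
  fix \<gamma> s t \<phi> assume \<gamma>: "\<gamma> \<in> E" and s: "s \<in> {0<..<1::real}" and t: "t \<in> time_open T0 T1"
    and \<phi>: "supertangent UNIV (\<lambda>(s, t). perron (\<gamma> s) t) (s, t) \<phi>"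
  have "admissible (H \<gamma>) K T (\<lambda>s t. perron (\<gamma> s) t)" using perron_in \<gamma> by (auto simp: subsolutions_def)
  moreover have "t \<in> interior T" using interior_maximal[OF time_open_subset open_time] t by blast
  ultimately show "hj_operator (H \<gamma>) \<phi> s t \<le> 0"
    using arc_hamiltonian.admissible_imp_subsolution[OF arc_ham[OF \<gamma>] _ s _ \<phi>] by blast
next
  fix x t0 \<psi> assume x: "x \<in> vertices E" and t0: "t0 \<in> time_open T0 T1" and \<psi>: "supertangent UNIV (perron x) t0 \<psi>"
  \<comment> \<open>Left difference quotients suffice: for \<open>t < t0\<close> contact and the
    vertex slope bound combine to \<open>\<psi> t0 - \<psi> t \<le> c x * (t0 - t)\<close>.\<close>
  have der: "(\<psi> has_real_derivative deriv \<psi> t0) (at t0 within {..<t0})"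
    using \<psi> C1_near_real_derivative by (auto simp: supertangent_def intro: has_field_derivative_at_within)
  obtain d where d: "d > 0" "\<And>t. \<bar>t - t0\<bar> < d \<Longrightarrow> t \<in> time_open T0 T1" using t0 by (rule time_openE) blast
  have "((\<lambda>t. (\<psi> t - \<psi> t0) / (t - t0)) \<longlongrightarrow> deriv \<psi> t0) (at_left t0)"
    using der by (simp add: has_field_derivative_iff)
  moreover have "\<forall>\<^sub>F t in at_left t0. (\<psi> t - \<psi> t0) / (t - t0) \<le> c x"
  proof -
    have "\<forall>\<^sub>F t in at_left t0. perron x t0 - \<psi> t0 \<ge> perron x t - \<psi> t"
      using \<psi> by (auto simp: supertangent_def intro: filter_leD[OF at_le[OF subset_UNIV]])
    moreover have "\<forall>\<^sub>F t in at_left t0. t \<in> {t0 - d<..<t0}"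
      using d by (intro eventually_at_left_real) auto
    ultimately show ?thesis
    proof eventually_elim
      case (elim t)
      then have "t \<in> T" "t0 \<in> T" using d(2)[of t] t0 time_open_subset by auto
      then have "perron x t0 - perron x t \<le> c x * (t0 - t)"
        using perron_in x elim by (auto simp: subsolutions_def)
      then have "c x * (t - t0) \<le> \<psi> t - \<psi> t0" using elim by (simp add: algebra_simps)
      then show ?case using elim by (simp add: divide_le_eq)
    qed
  qed
  ultimately show "deriv \<psi> t0 \<le> c x"
    by (rule tendsto_upperbound) simp
qed

section \<open>The supersolution property\<close>

text \<open>Allows a competitor to be checked on one orientation of each arc.\<close>

lemma reverse_admissible:
  assumes "\<gamma> \<in> E" "admissible (H (reversepath \<gamma>)) K T (\<lambda>s t. w (reversepath \<gamma> s) t)"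
  shows "admissible (H \<gamma>) K T (\<lambda>s t. w (\<gamma> s) t)"
proof -
  have "H (reversepath \<gamma>) (1 - s) (- p) = H \<gamma> s p" if "s \<in> {0..1}" for s p
    using ham assms(1) that unfolding hamiltonians_def by simp
  from admissible_reverse[OF assms(2), of "H \<gamma>", OF this[symmetric]]
  show ?thesis by (simp add: reversepath_apply)
qed

text \<open>A vertex is an endpoint of some arc. Disjointness of arc interiors leaves only
  \<open>\<gamma>\<close> and its inverse, and these are excluded by injectivity.\<close>

lemma vertex_not_interior:
  assumes "\<gamma> \<in> E" "s \<in> {0<..<1}"
  shows "\<gamma> s \<notin> vertices E"
proof
  assume "\<gamma> s \<in> vertices E"
  then obtain \<gamma>' e where e: "\<gamma>' \<in> E" "e \<in> {0, 1}" "\<gamma> s = \<gamma>' e" by (auto simp: vertices_def)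
  have s01: "s \<in> {0..1}" "e \<in> {0..1}" "1 - e \<in> {0..1}" using assms e by auto
  have "\<gamma>' = \<gamma> \<or> \<gamma>' = reversepath \<gamma>" using disjoint_E[OF assms(1) e(1) _ _ assms(2) s01(2)] e(3) by blast
  then have "\<gamma> s = \<gamma> e \<or> \<gamma> s = \<gamma> (1 - e)" using e by (auto simp: reversepath_apply)
  then have "s = e \<or> s = 1 - e" using inj_E[OF assms(1) s01(1)] s01 by blast
  then show False using e assms(2) by auto
qed

text \<open>The maximality argument, shared by interior points (\<open>S\<close> a single arc) and
  vertices (\<open>S\<close> the incoming arcs, \<open>\<sigma> = 1\<close>). The assumptions
  \<open>consistent\<close> and \<open>vert\<close> speak of the maximum with \<open>perron\<close>
  and not of \<open>\<psi>\<close> itself, because bumps on different arcs have to agree at a vertex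
  only where they exceed \<open>perron\<close>.\<close>

lemma perron_above_bump:
  fixes \<psi> :: "(real \<Rightarrow> real ^ 'n) \<Rightarrow> real \<Rightarrow> real \<Rightarrow> real" and \<sigma> t0 r :: real
  assumes S: "S \<subseteq> E" and r: "r > 0" and tr: "\<And>t. \<bar>t - t0\<bar> < r \<Longrightarrow> t \<in> time_open T0 T1"
    and consistent: "\<And>\<gamma> \<gamma>' s s'. \<lbrakk>\<gamma> \<in> S; \<gamma>' \<in> S; s \<in> {0..1}; s' \<in> {0..1}; \<gamma> s = \<gamma>' s'; \<bar>s - \<sigma>\<bar> < r\<rbrakk> \<Longrightarrow>
        \<bar>s' - \<sigma>\<bar> < r \<and> (\<forall>t. \<bar>t - t0\<bar> < r \<longrightarrow>
          max (perron (\<gamma> s) t) (\<psi> \<gamma> s t) = max (perron (\<gamma> s) t) (\<psi> \<gamma>' s' t))"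
    and apart: "\<And>\<gamma> \<gamma>' s s'. \<lbrakk>\<gamma> \<in> E; \<gamma> \<notin> S; reversepath \<gamma> \<notin> S; \<gamma>' \<in> S; s \<in> {0..1}; s' \<in> {0..1}; \<bar>s' - \<sigma>\<bar> < r\<rbrakk> \<Longrightarrow>
        \<gamma> s \<noteq> \<gamma>' s'"
    and incr: "\<And>\<gamma> \<alpha> \<beta> s t s' t'. \<lbrakk>\<gamma> \<in> S; 0 \<le> \<alpha>; \<alpha> < \<beta>; \<beta> \<le> 1; s \<in> {\<alpha>..\<beta>}; s' \<in> {\<alpha>..\<beta>};
        \<bar>s - \<sigma>\<bar> < r; \<bar>t - t0\<bar> < r; \<bar>s' - \<sigma>\<bar> < r; \<bar>t' - t0\<bar> < r\<rbrakk> \<Longrightarrow>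
        increment_le (gradients (H \<gamma>) K \<alpha> \<beta>) (\<psi> \<gamma>) s t s' t'"
    and low: "\<And>\<gamma> s t. \<lbrakk>\<gamma> \<in> S; s \<in> {0..1}; \<bar>s - \<sigma>\<bar> < r; \<bar>t - t0\<bar> < r; \<bar>s - \<sigma>\<bar> \<ge> r / 2 \<or> \<bar>t - t0\<bar> \<ge> r / 2\<rbrakk> \<Longrightarrow>
        \<psi> \<gamma> s t \<le> perron (\<gamma> s) t"
    and vert: "\<And>\<gamma> s. \<lbrakk>\<gamma> \<in> S; s \<in> {0..1}; \<bar>s - \<sigma>\<bar> < r; \<gamma> s \<in> vertices E\<rbrakk> \<Longrightarrow>
        \<exists>\<theta>. (\<forall>t. \<bar>t - t0\<bar> < r \<longrightarrow> max (perron (\<gamma> s) t) (\<psi> \<gamma> s t) = max (perron (\<gamma> s) t) (\<theta> t)) \<and>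
          (\<forall>t t'. t \<le> t' \<longrightarrow> \<theta> t' - \<theta> t \<le> c (\<gamma> s) * (t' - t))"
    and pt: "\<gamma> \<in> S" "s \<in> {0..1}" "\<bar>s - \<sigma>\<bar> < r" "\<bar>t - t0\<bar> < r"
  shows "\<psi> \<gamma> s t \<le> perron (\<gamma> s) t"
proof -
  \<comment> \<open>A point may lie on several arcs, so the glued value is first a relation;
    \<open>consistent\<close> makes the choice by \<open>SOME\<close> immaterial.\<close>
  define Q where "Q y t v \<longleftrightarrow> (\<exists>\<gamma>\<in>S. \<exists>s\<in>{0..1}. \<gamma> s = y \<and> \<bar>s - \<sigma>\<bar> < r \<and> v = max (perron y t) (\<psi> \<gamma> s t))" for y t v
  define w where "w y t = (if \<bar>t - t0\<bar> < r \<and> (\<exists>v. Q y t v) then SOME v. Q y t v else perron y t)" for y t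
  have w_in: "w (\<gamma> s) t = (if \<bar>s - \<sigma>\<bar> < r \<and> \<bar>t - t0\<bar> < r then max (perron (\<gamma> s) t) (\<psi> \<gamma> s t) else perron (\<gamma> s) t)"
    if \<gamma>: "\<gamma> \<in> S" "s \<in> {0..1}" for \<gamma> s t
  proof (cases "\<bar>t - t0\<bar> < r \<and> (\<exists>v. Q (\<gamma> s) t v)")
    case True
    then have "Q (\<gamma> s) t (w (\<gamma> s) t)" by (auto simp: w_def intro: someI)
    then obtain \<gamma>' s' where *: "\<gamma>' \<in> S" "s' \<in> {0..1}" "\<gamma>' s' = \<gamma> s" "\<bar>s' - \<sigma>\<bar> < r"
      "w (\<gamma> s) t = max (perron (\<gamma> s) t) (\<psi> \<gamma>' s' t)" unfolding Q_def by blast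
    with consistent[OF *(1) \<gamma>(1) *(2) \<gamma>(2) *(3,4)] True show ?thesis by auto
  next
    case False
    then have "\<not> (\<bar>s - \<sigma>\<bar> < r \<and> \<bar>t - t0\<bar> < r)" using \<gamma> unfolding Q_def by blast
    moreover have "w (\<gamma> s) t = perron (\<gamma> s) t" using False unfolding w_def by (rule if_not_P)
    ultimately show ?thesis by auto
  qed
  have w_out: "w y = perron y" if "\<And>\<gamma> s. \<gamma> \<in> S \<Longrightarrow> s \<in> {0..1} \<Longrightarrow> \<bar>s - \<sigma>\<bar> < r \<Longrightarrow> \<gamma> s \<noteq> y" for y
  proof
    fix t
    have "\<not> Q y t v" for v using that unfolding Q_def by blast
    then show "w y t = perron y t" by (simp add: w_def)
  qed
  have adm: "admissible (H \<gamma>) K T (\<lambda>s t. perron (\<gamma> s) t)" if "\<gamma> \<in> E" for \<gamma>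
    using perron_in that by (auto simp: subsolutions_def)
  have adm_S: "admissible (H \<gamma>) K T (\<lambda>s t. w (\<gamma> s) t)" if \<gamma>: "\<gamma> \<in> S" for \<gamma>
  proof (rule admissible_cong)
    show "admissible (H \<gamma>) K T (\<lambda>s t. if \<bar>s - \<sigma>\<bar> < r \<and> \<bar>t - t0\<bar> < r
        then max (perron (\<gamma> s) t) (\<psi> \<gamma> s t) else perron (\<gamma> s) t)"
      using S \<gamma> r by (intro admissible_max_bump interval_T adm incr low) auto
  qed (rule w_in[OF \<gamma>])
  have "w \<in> subsolutions"
    unfolding subsolutions_def
  proof (intro CollectI conjI ballI impI)
    fix \<gamma> assume \<gamma>: "\<gamma> \<in> E"
    show "admissible (H \<gamma>) K T (\<lambda>s t. w (\<gamma> s) t)"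
    proof -
      consider "\<gamma> \<in> S" | "reversepath \<gamma> \<in> S" | "\<gamma> \<notin> S" "reversepath \<gamma> \<notin> S" by blast
      then show ?thesis
      proof cases
        case 1 then show ?thesis by (rule adm_S)
      next
        case 2 show ?thesis by (rule reverse_admissible[OF \<gamma> adm_S[OF 2]])
      next
        case 3
        have "w (\<gamma> s) = perron (\<gamma> s)" if "s \<in> {0..1}" for s
        proof (rule w_out)
          fix \<gamma>' s' assume "\<gamma>' \<in> S" "s' \<in> {0..1}" "\<bar>s' - \<sigma>\<bar> < r"
          from apart[OF \<gamma> 3 this(1) that this(2,3)] show "\<gamma>' s' \<noteq> \<gamma> s" by (rule not_sym)
        qed
        then show ?thesis by (intro admissible_cong[OF adm[OF \<gamma>]]) simp
      qed
    qed
  next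
    fix x t t' assume x: "x \<in> vertices E" and t: "t \<in> T" "t' \<in> T" "t \<le> t'"
    have px: "perron x b - perron x a \<le> c x * (b - a)" if "a \<in> T" "b \<in> T" "a \<le> b" for a b
      using perron_in x that by (auto simp: subsolutions_def)
    show "w x t' - w x t \<le> c x * (t' - t)"
    proof (cases "\<exists>\<gamma>\<in>S. \<exists>s\<in>{0..1}. \<bar>s - \<sigma>\<bar> < r \<and> \<gamma> s = x")
      case True
      then obtain \<gamma> s where s: "\<gamma> \<in> S" "s \<in> {0..1}" "\<bar>s - \<sigma>\<bar> < r" "\<gamma> s = x" by blast
      then obtain \<theta> where \<theta>: "\<And>t. \<bar>t - t0\<bar> < r \<Longrightarrow> max (perron x t) (\<psi> \<gamma> s t) = max (perron x t) (\<theta> t)"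
          "\<And>t t'. t \<le> t' \<Longrightarrow> \<theta> t' - \<theta> t \<le> c x * (t' - t)"
        using vert[OF s(1-3)] x by blast
      have w: "w x t = (if \<bar>t - t0\<bar> < r then max (perron x t) (\<theta> t) else perron x t)" for t
        using w_in[OF s(1,2), of t] s \<theta>(1)[of t] by auto
      have "\<theta> t \<le> perron x t" if "\<bar>t - t0\<bar> < r" "\<bar>t - t0\<bar> \<ge> r / 2" for t
        using low[OF s(1-3) that(1)] that(2) \<theta>(1)[OF that(1)] s(4) by auto
      then show ?thesis
        unfolding w using t px \<theta>(2) by (intro increment_bound_max_bump[OF interval_T r]) auto
    next
      case False
      then have "w x = perron x" by (intro w_out) blast
      then show ?thesis using px t by simp
    qed
  next
    fix y assume y: "y \<in> support E"
    \<comment> \<open>The time window avoids \<open>T0\<close>, so the bump leaves the initial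
      values alone.\<close>
    have "\<not> \<bar>T0 - t0\<bar> < r" using tr[of T0] by (auto simp: time_open_def)
    then show "w y T0 \<le> g y" using perron_initial[OF y] by (simp add: w_def)
  qed
  then have "w (\<gamma> s) t \<le> perron (\<gamma> s) t"
    using pt S tr[of t] time_open_subset by (intro perron_upper arc_in_support) auto
  then show ?thesis using w_in[OF pt(1,2), of t] pt by auto
qed

text \<open>One step backward in time, compared with the rate \<open>M\<close> of
  \<open>perron\<close>. The rate \<open>K\<close> of a general member of the class would leave no
  room: perturbed slopes of a competitor must still be at least \<open>- K\<close>.\<close>

lemma time_slope_ge:
  assumes y: "y \<in> support E" and t0: "t0 \<in> time_open T0 T1"
    and ex: "\<And>e. e > 0 \<Longrightarrow> \<exists>d>0. \<forall>t. \<bar>t - t0\<bar> < d \<longrightarrow> perron y t0 + a * (t - t0) - e * \<bar>t - t0\<bar> \<le> perron y t"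
  shows "- M \<le> a"
proof (rule field_le_epsilon)
  fix e :: real assume "e > 0"
  then obtain d where d: "d > 0" "\<And>t. \<bar>t - t0\<bar> < d \<Longrightarrow> perron y t0 + a * (t - t0) - e * \<bar>t - t0\<bar> \<le> perron y t"
    using ex by blast
  obtain d' where d': "d' > 0" "\<And>t. \<bar>t - t0\<bar> < d' \<Longrightarrow> t \<in> time_open T0 T1" using t0 by (rule time_openE) blast
  define \<eta> where "\<eta> = min d d' / 2"
  have \<eta>: "0 < \<eta>" "\<eta> < d" "\<eta> < d'" using d d' by (auto simp: \<eta>_def)
  have "t0 - \<eta> \<in> T" "t0 \<in> T" using d'(2)[of "t0 - \<eta>"] t0 \<eta> time_open_subset by auto
  then have "perron y (t0 - \<eta>) - perron y t0 \<le> M * \<eta>" using perron_time(2)[OF y, of "t0 - \<eta>" t0] \<eta> by auto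
  moreover have "perron y t0 + a * (- \<eta>) - e * \<eta> \<le> perron y (t0 - \<eta>)" using d(2)[of "t0 - \<eta>"] \<eta> by auto
  ultimately have "(- M) * \<eta> \<le> (a + e) * \<eta>" by (simp add: algebra_simps)
  then show "- M \<le> a + e" using \<eta>(1) by (rule mult_right_le_imp_le)
qed

text \<open>Between two points the cone grows like an affine function whose slopes differ from
  \<open>a\<close> and \<open>p\<close> by at most \<open>e\<close>. That one gradient, admissible
  at the starting point \<open>s\<close> of the cell, bounds the increment.\<close>

lemma cone_increment:
  assumes h: "\<And>a' p' s. \<bar>a' - a\<bar> \<le> e \<Longrightarrow> \<bar>p' - p\<bar> \<le> e \<Longrightarrow> s \<in> {0..1} \<Longrightarrow> \<bar>s - \<sigma>\<bar> < r \<Longrightarrow> a' + h s p' \<le> 0"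
    and e: "0 \<le> e" "- K \<le> a - e"
    and f: "\<And>s t. f s t = b + a * (t - t0) + p * (s - \<sigma>) - e * (\<bar>t - t0\<bar> + \<bar>s - \<sigma>\<bar>)"
    and s: "0 \<le> \<alpha>" "\<beta> \<le> 1" "s \<in> {\<alpha>..\<beta>}" "\<bar>s - \<sigma>\<bar> < r"
  shows "increment_le (gradients h K \<alpha> \<beta>) f s t s' t'"
proof -
  obtain x where x: "\<bar>x\<bar> \<le> e" "e * \<bar>t - t0\<bar> - e * \<bar>t' - t0\<bar> = x * ((t' - t0) - (t - t0))"
    using e(1) by (rule mult_abs_increment)
  obtain y where y: "\<bar>y\<bar> \<le> e" "e * \<bar>s - \<sigma>\<bar> - e * \<bar>s' - \<sigma>\<bar> = y * ((s' - \<sigma>) - (s - \<sigma>))"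
    using e(1) by (rule mult_abs_increment)
  have "(a + x, p + y) \<in> gradients h K \<alpha> \<beta>"
    using h[of "a + x" "p + y" s] x y e s by (auto simp: gradients_def intro!: bexI[of _ s])
  then show ?thesis
    by (rule increment_le_gradient) (use x(2) y(2) in \<open>simp add: f algebra_simps\<close>)
qed

text \<open>Half of the gap \<open>2 * \<kappa>\<close> absorbs the change of the time slope, the
  other half the variation of the Hamiltonian. All smaller \<open>e\<close> are included so that
  finitely many arcs can share one scale.\<close>

lemma strict_gradient_stable:
  assumes \<gamma>: "\<gamma> \<in> E" and \<sigma>: "\<sigma> \<in> {0..1}" and neg: "a + H \<gamma> \<sigma> p < 0"
  shows "\<exists>d>0. \<forall>e. 0 < e \<and> e \<le> d \<longrightarrow> (\<forall>a' p' s. \<bar>a' - a\<bar> \<le> e \<longrightarrow> \<bar>p' - p\<bar> \<le> e \<longrightarrow> s \<in> {0..1} \<longrightarrow> \<bar>s - \<sigma>\<bar> < e \<longrightarrow>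
    a' + H \<gamma> s p' \<le> 0)"
proof -
  interpret arc_hamiltonian "H \<gamma>" K R by (rule arc_ham[OF \<gamma>])
  define \<kappa> where "\<kappa> = - (a + H \<gamma> \<sigma> p) / 2"
  have \<kappa>: "\<kappa> > 0" "a + H \<gamma> \<sigma> p = - 2 * \<kappa>" using neg by (auto simp: \<kappa>_def)
  obtain d where d: "d > 0" "\<And>s p1 p2. s \<in> {0..1} \<Longrightarrow> \<bar>s - \<sigma>\<bar> < d \<Longrightarrow> \<bar>p1\<bar> \<le> \<bar>p\<bar> + 1 \<Longrightarrow> \<bar>p2\<bar> \<le> \<bar>p\<bar> + 1 \<Longrightarrow>
      \<bar>p2 - p1\<bar> < d \<Longrightarrow> \<bar>H \<gamma> s p2 - H \<gamma> \<sigma> p1\<bar> < \<kappa>"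
    using near_in_space[OF \<sigma> \<kappa>(1), of "\<bar>p\<bar> + 1"] by metis
  show ?thesis
  proof (intro exI[of _ "min (min 1 \<kappa>) (d / 2)"] conjI allI impI)
    fix e a' p' s
    assume e: "0 < e \<and> e \<le> min (min 1 \<kappa>) (d / 2)" and h: "\<bar>a' - a\<bar> \<le> e" "\<bar>p' - p\<bar> \<le> e" "s \<in> {0..1}" "\<bar>s - \<sigma>\<bar> < e"
    have "\<bar>H \<gamma> s p' - H \<gamma> \<sigma> p\<bar> < \<kappa>" using e h d(1) by (intro d(2)) auto
    then show "a' + H \<gamma> s p' \<le> 0" using \<kappa> e h by auto
  qed (use \<kappa> d in auto)
qed

text \<open>If the inequality fails, the affine part of the test function, lowered by a steeper cone
  than the contact estimate allows for and raised slightly at the apex, is a bump above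
  \<open>perron\<close>.\<close>

lemma perron_supersolution_arc:
  assumes \<gamma>: "\<gamma> \<in> E"
  shows "arc_supersolution T0 T1 (H \<gamma>) (\<lambda>(s, t). perron (\<gamma> s) t)"
  unfolding arc_supersolution_def
proof (intro ballI allI impI, rule ccontr)
  fix s0 t0 \<phi>
  assume s0: "s0 \<in> {0<..<1::real}" and t0: "t0 \<in> time_open T0 T1"
    and \<phi>: "subtangent UNIV (\<lambda>(s, t). perron (\<gamma> s) t) (s0, t0) \<phi>"
    and "\<not> 0 \<le> hj_operator (H \<gamma>) \<phi> s0 t0"
  moreover obtain a p where ap: "\<And>h. hj_operator h \<phi> s0 t0 = a + h s0 p"
    and ex: "\<And>e. e > 0 \<Longrightarrow> \<exists>d>0. \<forall>s t. \<bar>s - s0\<bar> < d \<longrightarrow> \<bar>t - t0\<bar> < d \<longrightarrow>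
       perron (\<gamma> s0) t0 + a * (t - t0) + p * (s - s0) - e * (\<bar>s - s0\<bar> + \<bar>t - t0\<bar>) \<le> perron (\<gamma> s) t"
    using subtangent_expansion[OF \<phi>] by (auto 4 3)
  ultimately have neg: "a + H \<gamma> s0 p < 0" by simp
  have s01: "s0 \<in> {0..1}" using s0 by auto
  have "- M \<le> a"
  proof (rule time_slope_ge[OF arc_in_support[OF \<gamma> s01] t0])
    fix e :: real assume "e > 0"
    from ex[OF this] obtain d where d: "d > 0" "\<And>s t. \<bar>s - s0\<bar> < d \<Longrightarrow> \<bar>t - t0\<bar> < d \<Longrightarrow>
       perron (\<gamma> s0) t0 + a * (t - t0) + p * (s - s0) - e * (\<bar>s - s0\<bar> + \<bar>t - t0\<bar>) \<le> perron (\<gamma> s) t" by blast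
    show "\<exists>d>0. \<forall>t. \<bar>t - t0\<bar> < d \<longrightarrow> perron (\<gamma> s0) t0 + a * (t - t0) - e * \<bar>t - t0\<bar> \<le> perron (\<gamma> s0) t"
      using d(1) d(2)[of s0] by (intro exI[of _ d]) auto
  qed
  obtain d1 where d1: "d1 > 0" "\<forall>e. 0 < e \<and> e \<le> d1 \<longrightarrow> (\<forall>a' p' s. \<bar>a' - a\<bar> \<le> e \<longrightarrow> \<bar>p' - p\<bar> \<le> e \<longrightarrow> s \<in> {0..1} \<longrightarrow> \<bar>s - s0\<bar> < e \<longrightarrow>
    a' + H \<gamma> s p' \<le> 0)" using strict_gradient_stable[OF \<gamma> s01 neg] by blast
  \<comment> \<open>The contact estimate uses a cone of slope \<open>\<delta>\<close>, the
    competitor one of slope \<open>2 * \<delta>\<close>; the bound 1 is the gap between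
    \<open>K\<close> and \<open>M\<close>.\<close>
  define \<delta> where "\<delta> = min d1 1 / 2"
  have \<delta>: "\<delta> > 0" "2 * \<delta> \<le> d1" "2 * \<delta> \<le> 1" using d1 by (auto simp: \<delta>_def)
  obtain d2 where d2: "d2 > 0" "\<And>s t. \<bar>s - s0\<bar> < d2 \<Longrightarrow> \<bar>t - t0\<bar> < d2 \<Longrightarrow>
       perron (\<gamma> s0) t0 + a * (t - t0) + p * (s - s0) - \<delta> * (\<bar>s - s0\<bar> + \<bar>t - t0\<bar>) \<le> perron (\<gamma> s) t"
    using ex[OF \<delta>(1)] by blast
  obtain d3 where d3: "d3 > 0" "\<And>t. \<bar>t - t0\<bar> < d3 \<Longrightarrow> t \<in> time_open T0 T1" using t0 by (rule time_openE) blast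
  \<comment> \<open>\<open>2 * \<delta>\<close> is a range where perturbed gradients stay
    admissible, \<open>d2\<close> that of the contact estimate, \<open>d3\<close> keeps the times
    inside the interval, and the last term keeps vertices out.\<close>
  define r where "r = min (min (2 * \<delta>) d2) (min d3 (min s0 (1 - s0)))"
  have r: "r > 0" "r \<le> 2 * \<delta>" "r \<le> d2" "r \<le> d3" "r \<le> s0" "r \<le> 1 - s0"
    using \<delta> d2 d3 s0 by (auto simp: r_def min_less_iff_disj)
  \<comment> \<open>Outside the half-size box the steeper cone has lost at least this much against
    the contact cone.\<close>
  define \<epsilon> where "\<epsilon> = \<delta> * r / 2"
  have \<epsilon>: "\<epsilon> > 0" using \<delta> r by (simp add: \<epsilon>_def)
  define \<psi> where "\<psi> s t = perron (\<gamma> s0) t0 + \<epsilon> + a * (t - t0) + p * (s - s0) - 2 * \<delta> * (\<bar>t - t0\<bar> + \<bar>s - s0\<bar>)" for s t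
  have interior: "s \<in> {0<..<1}" if "\<bar>s - s0\<bar> < r" for s using that r by auto
  have "\<psi> s0 t0 \<le> perron (\<gamma> s0) t0"
  proof (rule perron_above_bump[where S="{\<gamma>}" and r=r and \<sigma>=s0 and ?t0.0=t0 and \<psi>="\<lambda>_. \<psi>"])
    show "{\<gamma>} \<subseteq> E" using \<gamma> by simp
    fix \<gamma>1 \<gamma>2 and s s' :: real
    assume h: "\<gamma>1 \<in> E" "\<gamma>1 \<notin> {\<gamma>}" "reversepath \<gamma>1 \<notin> {\<gamma>}" "\<gamma>2 \<in> {\<gamma>}" "s \<in> {0..1}" "s' \<in> {0..1}" "\<bar>s' - s0\<bar> < r"
    then have "\<gamma>1 \<noteq> reversepath \<gamma>" by auto
    then show "\<gamma>1 s \<noteq> \<gamma>2 s'" using disjoint_E[OF \<gamma> h(1) _ _ interior[OF h(7)] h(5)] h by auto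
  next
    fix \<gamma>1 \<gamma>2 and s s' :: real
    assume h: "\<gamma>1 \<in> {\<gamma>}" "\<gamma>2 \<in> {\<gamma>}" "s \<in> {0..1}" "s' \<in> {0..1}" "\<gamma>1 s = \<gamma>2 s'" "\<bar>s - s0\<bar> < r"
    then have "s = s'" using inj_E[OF \<gamma>] by auto
    then show "\<bar>s' - s0\<bar> < r \<and> (\<forall>t. \<bar>t - t0\<bar> < r \<longrightarrow> max (perron (\<gamma>1 s) t) (\<psi> s t) = max (perron (\<gamma>1 s) t) (\<psi> s' t))"
      using h by auto
  next
    fix \<gamma>1 \<alpha> \<beta> s t s' t'
    assume h: "\<gamma>1 \<in> {\<gamma>}" "0 \<le> \<alpha>" "\<alpha> < \<beta>" "\<beta> \<le> 1" "s \<in> {\<alpha>..\<beta>}" "s' \<in> {\<alpha>..\<beta>}" "\<bar>s - s0\<bar> < r"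
    have "increment_le (gradients (H \<gamma>) K \<alpha> \<beta>) \<psi> s t s' t'"
    proof (rule cone_increment[where b="perron (\<gamma> s0) t0 + \<epsilon>" and a=a and p=p and e="2 * \<delta>"
          and r=r and \<sigma>=s0 and ?t0.0=t0])
      fix a' p' s assume "\<bar>a' - a\<bar> \<le> 2 * \<delta>" "\<bar>p' - p\<bar> \<le> 2 * \<delta>" "s \<in> {0..1}" "\<bar>s - s0\<bar> < r"
      then show "a' + H \<gamma> s p' \<le> 0" using d1(2)[rule_format, of "2 * \<delta>" a' p' s] \<delta> r by auto
    next
      show "- K \<le> a - 2 * \<delta>" using \<open>- M \<le> a\<close> \<delta> by (simp add: K_def)
    qed (use h \<delta> \<psi>_def in auto)
    then show "increment_le (gradients (H \<gamma>1) K \<alpha> \<beta>) \<psi> s t s' t'" using h(1) by simp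
  next
    fix \<gamma>1 s t
    assume h: "\<gamma>1 \<in> {\<gamma>}" "s \<in> {0..1}" "\<bar>s - s0\<bar> < r" "\<bar>t - t0\<bar> < r" "\<bar>s - s0\<bar> \<ge> r / 2 \<or> \<bar>t - t0\<bar> \<ge> r / 2"
    have "r / 2 \<le> \<bar>s - s0\<bar> + \<bar>t - t0\<bar>" using h(5) by linarith
    then have "\<delta> * (r / 2) \<le> \<delta> * (\<bar>s - s0\<bar> + \<bar>t - t0\<bar>)" using \<delta> by (intro mult_left_mono) auto
    then show "\<psi> s t \<le> perron (\<gamma>1 s) t"
      using d2(2)[of s t] h r by (auto simp: \<psi>_def \<epsilon>_def algebra_simps)
  next
    fix \<gamma>1 and s :: real assume "\<gamma>1 \<in> {\<gamma>}" "\<bar>s - s0\<bar> < r" "\<gamma>1 s \<in> vertices E"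
    then have False using vertex_not_interior[OF \<gamma> interior] by auto
    then show "\<exists>\<theta>. (\<forall>t. \<bar>t - t0\<bar> < r \<longrightarrow> max (perron (\<gamma>1 s) t) (\<psi> s t) = max (perron (\<gamma>1 s) t) (\<theta> t)) \<and>
          (\<forall>t t'. t \<le> t' \<longrightarrow> \<theta> t' - \<theta> t \<le> c (\<gamma>1 s) * (t' - t))" ..
  qed (use r d3 s01 in auto)
  then show False using \<epsilon> by (simp add: \<psi>_def)
qed

text \<open>The flux limiter bounds \<open>c x\<close> by
  \<open>- max_s min_p H \<gamma> s p\<close>, hence by \<open>- min_p H \<gamma> 1 p\<close>.
  Boundedness is checked first, since \<open>SUP\<close> and \<open>INF\<close> of unbounded sets of
  reals are unspecified; the values at \<open>p = 0\<close> bound all infima from above.\<close>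

lemma flux_strict:
  assumes x: "x \<in> vertices E" and \<gamma>: "\<gamma> \<in> arcs_into E x" and b: "b < c x"
  shows "\<exists>q. b + H \<gamma> 1 q < 0"
proof -
  have \<gamma>E: "\<gamma> \<in> E" using \<gamma> by (simp add: arcs_into_def)
  interpret arc_hamiltonian "H \<gamma>" K R by (rule arc_ham[OF \<gamma>E])
  have below: "bdd_below (range (H \<gamma> s))" if "s \<in> {0..1}" for s
    using pos[OF that] by (auto intro!: bdd_belowI[of _ 0] less_imp_le)
  have "continuous_on {0..1} (\<lambda>s. case (s, 0) of (s, p) \<Rightarrow> H \<gamma> s p)"
    by (rule continuous_on_compose2[OF cont]) (auto intro!: continuous_on_Pair continuous_on_id continuous_on_const)
  then have "compact ((\<lambda>s. H \<gamma> s 0) ` {0..1})"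
    by (intro compact_continuous_image) auto
  then have "bdd_above ((\<lambda>s. H \<gamma> s 0) ` {0..1})" by (intro bounded_imp_bdd_above compact_imp_bounded)
  then obtain B where B: "\<And>s. s \<in> {0..1} \<Longrightarrow> H \<gamma> s 0 \<le> B" unfolding bdd_above_def by blast
  have "bdd_above ((\<lambda>s. INF p. H \<gamma> s p) ` {0..1})"
    by (intro bdd_aboveI2[where M=B] order_trans[OF cINF_lower[OF below] B]) auto
  then have "(INF p. H \<gamma> 1 p) \<le> (SUP s\<in>{0..1}. INF p. H \<gamma> s p)" by (intro cSUP_upper) auto
  also have "\<dots> = - arc_const H \<gamma>" by (simp add: arc_const_def)
  also have "\<dots> \<le> - c x"
  proof -
    have "c x \<le> Min (arc_const H ` arcs_into E x)" using flux x by (simp add: flux_limiter_def)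
    also have "\<dots> \<le> arc_const H \<gamma>" using \<gamma> finite_E by (intro Min_le) (auto simp: arcs_into_def)
    finally show ?thesis by simp
  qed
  finally have "(INF p. H \<gamma> 1 p) < - b" using b by simp
  then obtain q where "H \<gamma> 1 q < - b" using cInf_lessD[of "range (H \<gamma> 1)" "- b"] by auto
  then show ?thesis by (intro exI[of _ q]) simp
qed

section \<open>Incoming arcs and the vertex condition\<close>

lemma arcs_into_nonempty: "x \<in> vertices E \<Longrightarrow> arcs_into E x \<noteq> {}"
  using reverse_E by (fastforce simp: vertices_def arcs_into_def reversepath_apply)

text \<open>Distinct incoming arcs may also share their initial points, hence \<open>s > 0\<close>.
  The inverse of an incoming arc ends at another vertex, so it does not compete with
  disjointness.\<close>

lemma arcs_into_meet:
  assumes "\<gamma> \<in> arcs_into E x" "\<gamma>' \<in> arcs_into E x" "s \<in> {0<..1}" "s' \<in> {0..1}" "\<gamma> s = \<gamma>' s'"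
  shows "s = s' \<and> (s = 1 \<or> \<gamma> = \<gamma>')"
proof -
  have E: "\<gamma> \<in> E" "\<gamma>' \<in> E" "\<gamma> 1 = x" "\<gamma>' 1 = x" using assms by (auto simp: arcs_into_def)
  have "reversepath \<gamma> 1 \<noteq> \<gamma> 1"
    using inj_E[OF E(1), of 0 1] by (auto simp: reversepath_apply)
  then have nr: "\<gamma>' \<noteq> reversepath \<gamma>" using E by auto
  show ?thesis
  proof (cases "\<gamma>' = \<gamma>")
    case True
    then show ?thesis using inj_E[OF E(1), of s s'] assms by auto
  next
    case False
    then have "\<not> s \<in> {0<..<1}" using disjoint_E[OF E(1,2) False nr _ assms(4)] assms(5) by blast
    then have "s = 1" using assms(3) by auto
    then have "\<gamma>' s' = \<gamma>' 1" using assms(5) E(3,4) by metis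
    then have "s' = 1" using inj_E[OF E(2) assms(4), of 1] by simp
    then show ?thesis using \<open>s = 1\<close> by simp
  qed
qed

text \<open>With \<open>arcs_into_meet\<close> this allows a competitor to be changed near
  \<open>x\<close> on the incoming arcs alone. The parameter \<open>s' = 0\<close> is excluded
  because other arcs may end there.\<close>

lemma arcs_into_apart:
  assumes "\<gamma> \<in> E" "\<gamma> \<notin> arcs_into E x" "reversepath \<gamma> \<notin> arcs_into E x" "\<gamma>' \<in> arcs_into E x"
    and "s \<in> {0..1}" "s' \<in> {0<..1}"
  shows "\<gamma> s \<noteq> \<gamma>' s'"
proof
  assume eq: "\<gamma> s = \<gamma>' s'"
  have E: "\<gamma>' \<in> E" "\<gamma>' 1 = x" "\<gamma> 1 \<noteq> x" "\<gamma> 0 \<noteq> x"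
    using assms(1-4) reverse_E[OF assms(1)] by (auto simp: arcs_into_def reversepath_apply)
  have ne: "\<gamma> \<noteq> \<gamma>'" "\<gamma> \<noteq> reversepath \<gamma>'" "\<gamma>' \<noteq> reversepath \<gamma>"
    using assms(2-4) reversepath_reversepath[of \<gamma>'] by metis+
  show False
  proof (cases "s' = 1")
    case True
    then have "s \<noteq> 0" "s \<noteq> 1" using eq E by auto
    then have "s \<in> {0<..<1}" using assms by auto
    then show False using disjoint_E[OF assms(1) E(1) _ ne(3), of s s'] ne eq assms(6) by auto
  next
    case False
    then have "s' \<in> {0<..<1}" using assms by auto
    then show False using disjoint_E[OF E(1) assms(1) ne(1,2), of s' s] eq assms(5) by auto
  qed
qed

text \<open>On each incoming arc the competitor is the minimum of two strict, piecewise affine subsolutions.  Near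
  the vertex the first one is active: its time slope is that of the test function of the trace, hence
  common to all arcs and below \<open>c x\<close>, and its space slope exists because of the flux limiter
  condition.  The second one, modelled on the failing test function of the arc, forces the competitor
  below the maximal subsolution away from the vertex.\<close>

lemma perron_supersolution_vertex:
  assumes x: "x \<in> vertices E" and t0: "t0 \<in> time_open T0 T1"
    and \<phi>: "subtangent UNIV (perron x) t0 \<phi>" and less: "deriv \<phi> t0 < c x"
  shows "\<exists>\<gamma>\<in>arcs_into E x. \<forall>\<phi>.
    subtangent ({0..1} \<times> closure (time_open T0 T1)) (\<lambda>(s, t). perron (\<gamma> s) t) (1, t0) \<phi> \<longrightarrow>
    hj_operator (H \<gamma>) \<phi> 1 t0 \<ge> 0"
proof (rule ccontr)
  assume contra: "\<not> ?thesis"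
  define S where "S = arcs_into E x"
  define u0 where "u0 = perron x t0"
  define a0 where "a0 = deriv \<phi> t0"
  have S: "finite S" "S \<subseteq> E" "\<And>\<gamma>. \<gamma> \<in> S \<Longrightarrow> \<gamma> \<in> E" "\<And>\<gamma>. \<gamma> \<in> S \<Longrightarrow> \<gamma> 1 = x" using finite_E by (auto simp: S_def arcs_into_def)
  obtain d3 where d3: "d3 > 0" "\<And>t. \<bar>t - t0\<bar> < d3 \<Longrightarrow> t \<in> time_open T0 T1" using t0 by (rule time_openE) blast
  have trace: "\<exists>d>0. \<forall>t. \<bar>t - t0\<bar> < d \<longrightarrow> u0 + a0 * (t - t0) - e * \<bar>t - t0\<bar> \<le> perron x t" if e: "e > 0" for e
  proof -
    have "(\<phi> has_derivative (*) a0) (at t0)"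
      using \<phi> C1_near_real_derivative[of \<phi> t0] by (auto simp: subtangent_def a0_def has_field_derivative_def)
    then obtain d where d: "d > 0" "\<And>t. norm (t - t0) < d \<Longrightarrow> norm (\<phi> t - \<phi> t0 - a0 * (t - t0)) \<le> e * norm (t - t0)"
      using e unfolding has_derivative_at_alt by blast
    obtain d' where d': "d' > 0" "\<And>t. t \<noteq> t0 \<and> dist t t0 < d' \<Longrightarrow> perron x t0 - \<phi> t0 \<le> perron x t - \<phi> t"
      using \<phi> unfolding subtangent_def eventually_at by blast
    show ?thesis
    proof (intro exI[of _ "min d d'"] conjI allI impI)
      fix t assume t: "\<bar>t - t0\<bar> < min d d'"
      then show "u0 + a0 * (t - t0) - e * \<bar>t - t0\<bar> \<le> perron x t"
        using d(2)[of t] d'(2)[of t] by (cases "t = t0") (auto simp: u0_def dist_real_def)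
    qed (use d d' in auto)
  qed
  \<comment> \<open>By contradiction every incoming arc has a failing test function, with slopes
    that depend on the arc.\<close>
  have "\<exists>a p. a + H \<gamma> 1 p < 0 \<and> (\<forall>e>0. \<exists>d>0. \<forall>s t. s \<in> {0..1} \<longrightarrow> \<bar>s - 1\<bar> < d \<longrightarrow> \<bar>t - t0\<bar> < d \<longrightarrow>
      u0 + a * (t - t0) + p * (s - 1) - e * (\<bar>s - 1\<bar> + \<bar>t - t0\<bar>) \<le> perron (\<gamma> s) t)" if \<gamma>: "\<gamma> \<in> S" for \<gamma>
  proof -
    obtain \<phi>' where \<phi>': "subtangent ({0..1} \<times> closure (time_open T0 T1)) (\<lambda>(s, t). perron (\<gamma> s) t) (1, t0) \<phi>'"
      and neg: "\<not> hj_operator (H \<gamma>) \<phi>' 1 t0 \<ge> 0" using contra \<gamma> unfolding S_def by blast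
    obtain a p where ap: "\<And>h. hj_operator h \<phi>' 1 t0 = a + h 1 p"
      and ex: "\<And>e. e > 0 \<Longrightarrow> \<exists>d>0. \<forall>s t. (s, t) \<in> {0..1} \<times> closure (time_open T0 T1) \<longrightarrow> \<bar>s - 1\<bar> < d \<longrightarrow> \<bar>t - t0\<bar> < d \<longrightarrow>
       perron (\<gamma> 1) t0 + a * (t - t0) + p * (s - 1) - e * (\<bar>s - 1\<bar> + \<bar>t - t0\<bar>) \<le> perron (\<gamma> s) t"
      using subtangent_expansion[OF \<phi>'] by (auto 4 3)
    have "\<exists>d>0. \<forall>s t. s \<in> {0..1} \<longrightarrow> \<bar>s - 1\<bar> < d \<longrightarrow> \<bar>t - t0\<bar> < d \<longrightarrow>
      u0 + a * (t - t0) + p * (s - 1) - e * (\<bar>s - 1\<bar> + \<bar>t - t0\<bar>) \<le> perron (\<gamma> s) t" if e: "e > 0" for e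
    proof -
      obtain d where d: "d > 0" "\<And>s t. (s, t) \<in> {0..1} \<times> closure (time_open T0 T1) \<Longrightarrow> \<bar>s - 1\<bar> < d \<Longrightarrow> \<bar>t - t0\<bar> < d \<Longrightarrow>
         perron (\<gamma> 1) t0 + a * (t - t0) + p * (s - 1) - e * (\<bar>s - 1\<bar> + \<bar>t - t0\<bar>) \<le> perron (\<gamma> s) t"
        using ex[OF e] by blast
      show ?thesis
      proof (intro exI[of _ "min d d3"] conjI allI impI)
        fix s t assume h: "s \<in> {0..1::real}" "\<bar>s - 1\<bar> < min d d3" "\<bar>t - t0\<bar> < min d d3"
        then have "(s, t) \<in> {0..1} \<times> closure (time_open T0 T1)"
          using d3(2)[of t] closure_subset by auto
        from d(2)[OF this] show "u0 + a * (t - t0) + p * (s - 1) - e * (\<bar>s - 1\<bar> + \<bar>t - t0\<bar>) \<le> perron (\<gamma> s) t"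
          using h S(4)[OF \<gamma>] by (auto simp: u0_def)
      qed (use d d3 in auto)
    qed
    then show ?thesis using ap neg by (intro exI[of _ a] exI[of _ p]) auto
  qed
  then obtain a p where neg: "\<And>\<gamma>. \<gamma> \<in> S \<Longrightarrow> a \<gamma> + H \<gamma> 1 (p \<gamma>) < 0"
    and ex: "\<And>\<gamma> e. \<gamma> \<in> S \<Longrightarrow> e > 0 \<Longrightarrow> \<exists>d>0. \<forall>s t. s \<in> {0..1} \<longrightarrow> \<bar>s - 1\<bar> < d \<longrightarrow> \<bar>t - t0\<bar> < d \<longrightarrow>
      u0 + a \<gamma> * (t - t0) + p \<gamma> * (s - 1) - e * (\<bar>s - 1\<bar> + \<bar>t - t0\<bar>) \<le> perron (\<gamma> s) t" by metis
  have "\<forall>\<gamma>\<in>S. \<exists>q. a0 + H \<gamma> 1 q < 0" using flux_strict[OF x _ less] by (auto simp: S_def a0_def)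
  then obtain q where q: "\<And>\<gamma>. \<gamma> \<in> S \<Longrightarrow> a0 + H \<gamma> 1 (q \<gamma>) < 0" by metis
  \<comment> \<open>With the same bounds for \<open>a \<gamma>\<close>, the mismatch
    \<open>\<bar>a0 - a \<gamma>\<bar>\<close> of the time slopes is at most
    \<open>2 * M\<close>.\<close>
  have a0: "- M \<le> a0" "a0 \<le> M" "a0 < c x"
    using time_slope_ge[OF vertex_support[OF x] t0 trace[unfolded u0_def]] less c_bound[OF x] by (auto simp: a0_def)
  have a: "- M \<le> a \<gamma>" "a \<gamma> \<le> M" if \<gamma>: "\<gamma> \<in> S" for \<gamma>
  proof -
    show "- M \<le> a \<gamma>"
    proof (rule time_slope_ge[OF vertex_support[OF x] t0])
      fix e :: real assume "e > 0"
      from ex[OF \<gamma> this] obtain d where "d > 0" "\<And>s t. s \<in> {0..1} \<Longrightarrow> \<bar>s - 1\<bar> < d \<Longrightarrow> \<bar>t - t0\<bar> < d \<Longrightarrow>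
        u0 + a \<gamma> * (t - t0) + p \<gamma> * (s - 1) - e * (\<bar>s - 1\<bar> + \<bar>t - t0\<bar>) \<le> perron (\<gamma> s) t" by blast
      note d = this(1) this(2)[of 1]
      show "\<exists>d>0. \<forall>t. \<bar>t - t0\<bar> < d \<longrightarrow> perron x t0 + a \<gamma> * (t - t0) - e * \<bar>t - t0\<bar> \<le> perron x t"
        using d S(4)[OF \<gamma>] by (intro exI[of _ d]) (auto simp: u0_def)
    qed
    have "H \<gamma> 1 (p \<gamma>) > 0" using arc_hamiltonian.pos[OF arc_ham[OF S(3)[OF \<gamma>]], of 1] by simp
    then show "a \<gamma> \<le> M" using neg[OF \<gamma>] M_nonneg by simp
  qed
  have one: "(1::real) \<in> {0..1}" by simp
  define stable where "stable \<gamma> b m e \<longleftrightarrow> (\<forall>a' p' s. \<bar>a' - b\<bar> \<le> e \<longrightarrow> \<bar>p' - m\<bar> \<le> e \<longrightarrow> s \<in> {0..1} \<longrightarrow> \<bar>s - 1\<bar> < e \<longrightarrow>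
    a' + H \<gamma> s p' \<le> 0)" for \<gamma> b m e
  have "\<exists>d>0. \<forall>e. 0 < e \<and> e \<le> d \<longrightarrow> stable \<gamma> (a \<gamma>) (p \<gamma>) e" if "\<gamma> \<in> S" for \<gamma>
    using strict_gradient_stable[OF S(3)[OF that] one neg[OF that]] unfolding stable_def .
  then obtain d1 where d1: "d1 > 0" "\<And>\<gamma> e. \<gamma> \<in> S \<Longrightarrow> 0 < e \<Longrightarrow> e \<le> d1 \<Longrightarrow> stable \<gamma> (a \<gamma>) (p \<gamma>) e"
    using finite_common_radius[OF S(1), of "\<lambda>\<gamma>. stable \<gamma> (a \<gamma>) (p \<gamma>)"] by blast
  have "\<exists>d>0. \<forall>e. 0 < e \<and> e \<le> d \<longrightarrow> stable \<gamma> a0 (q \<gamma>) e" if "\<gamma> \<in> S" for \<gamma>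
    using strict_gradient_stable[OF S(3)[OF that] one q[OF that]] unfolding stable_def .
  then obtain d1' where d1': "d1' > 0" "\<And>\<gamma> e. \<gamma> \<in> S \<Longrightarrow> 0 < e \<Longrightarrow> e \<le> d1' \<Longrightarrow> stable \<gamma> a0 (q \<gamma>) e"
    using finite_common_radius[OF S(1), of "\<lambda>\<gamma>. stable \<gamma> a0 (q \<gamma>)"] by blast
  \<comment> \<open>The term \<open>c x - a0\<close> keeps the steepest slope
    \<open>a0 + 2 * \<delta>\<close> of the trace of the competitor at most
    \<open>c x\<close>.\<close>
  define \<delta> where "\<delta> = min (min d1 d1') (min 1 (c x - a0)) / 2"
  have \<delta>: "\<delta> > 0" "2 * \<delta> \<le> d1" "2 * \<delta> \<le> d1'" "2 * \<delta> \<le> 1" "2 * \<delta> \<le> c x - a0"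
    using d1 d1' a0 by (auto simp: \<delta>_def min_less_iff_disj)
  define touching where "touching \<gamma> e \<longleftrightarrow> (\<forall>s t. s \<in> {0..1} \<longrightarrow> \<bar>s - 1\<bar> < e \<longrightarrow> \<bar>t - t0\<bar> < e \<longrightarrow>
      u0 + a \<gamma> * (t - t0) + p \<gamma> * (s - 1) - \<delta> * (\<bar>s - 1\<bar> + \<bar>t - t0\<bar>) \<le> perron (\<gamma> s) t)" for \<gamma> e
  have "\<exists>d>0. \<forall>e. 0 < e \<and> e \<le> d \<longrightarrow> touching \<gamma> e" if "\<gamma> \<in> S" for \<gamma>
    using ex[OF that \<delta>(1)] unfolding touching_def by fastforce
  then obtain d2 where d2: "d2 > 0" "\<And>\<gamma> e. \<gamma> \<in> S \<Longrightarrow> 0 < e \<Longrightarrow> e \<le> d2 \<Longrightarrow> touching \<gamma> e"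
    using finite_common_radius[OF S(1), of touching] by blast
  obtain d4 where d4: "d4 > 0" "\<And>t. \<bar>t - t0\<bar> < d4 \<Longrightarrow> u0 + a0 * (t - t0) - \<delta> * \<bar>t - t0\<bar> \<le> perron x t"
    using trace[OF \<delta>(1)] by blast
  define r where "r = min (min (2 * \<delta>) d2) (min d3 (min d4 1))"
  have r: "r > 0" "r \<le> 2 * \<delta>" "r \<le> d2" "r \<le> d3" "r \<le> d4" "r \<le> 1"
    using \<delta> d2 d3 d4 by (auto simp: r_def min_less_iff_disj)
  \<comment> \<open>\<open>l\<close> is the height at which \<open>f2\<close> still drops below
    \<open>perron\<close> outside the half-size box. At the vertex \<open>f1\<close> can exceed
    \<open>perron\<close> only while \<open>\<delta> * \<bar>t - t0\<bar> \<le> \<epsilon>\<close>;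
    there the mismatch of time slopes costs at most \<open>2 * M * \<epsilon> / \<delta>\<close>,
    and \<open>\<epsilon>\<close> is chosen so that \<open>\<epsilon>\<close> and this cost add up
    to \<open>l\<close>. Hence \<open>f1\<close> is the smaller function there.\<close>
  define l where "l = \<delta> * r / 2"
  define \<epsilon> where "\<epsilon> = l / (1 + 2 * M / \<delta>)"
  have l: "l > 0" using \<delta> r by (simp add: l_def)
  have M1: "1 + 2 * M / \<delta> > 0" using M_nonneg \<delta> by (intro add_pos_nonneg) auto
  then have \<epsilon>: "\<epsilon> > 0" using l by (simp add: \<epsilon>_def)
  have \<epsilon>_l: "\<epsilon> + 2 * M * (\<epsilon> / \<delta>) = l"
  proof -
    have "\<epsilon> * (1 + 2 * M / \<delta>) = l" using M1 by (simp add: \<epsilon>_def)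
    then show ?thesis by (simp add: algebra_simps)
  qed
  define f1 where "f1 \<gamma> s t = u0 + \<epsilon> + a0 * (t - t0) + q \<gamma> * (s - 1) - 2 * \<delta> * (\<bar>t - t0\<bar> + \<bar>s - 1\<bar>)" for \<gamma> s t
  define f2 where "f2 \<gamma> s t = u0 + l + a \<gamma> * (t - t0) + p \<gamma> * (s - 1) - 2 * \<delta> * (\<bar>t - t0\<bar> + \<bar>s - 1\<bar>)" for \<gamma> s t
  define \<psi> where "\<psi> \<gamma> s t = min (f1 \<gamma> s t) (f2 \<gamma> s t)" for \<gamma> s t
  \<comment> \<open>The trace of \<open>f1\<close> at the vertex, the same for all arcs.\<close>
  define \<theta> where "\<theta> t = u0 + \<epsilon> + a0 * (t - t0) - 2 * \<delta> * \<bar>t - t0\<bar>" for t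
  have trace_eq: "max (perron x t) (\<psi> \<gamma> 1 t) = max (perron x t) (\<theta> t)" if \<gamma>: "\<gamma> \<in> S" and t: "\<bar>t - t0\<bar> < r" for \<gamma> t
  proof (cases "\<delta> * \<bar>t - t0\<bar> \<le> \<epsilon>")
    case True
    then have "\<bar>t - t0\<bar> \<le> \<epsilon> / \<delta>" using \<delta> by (simp add: field_simps)
    moreover have "\<bar>a0 - a \<gamma>\<bar> \<le> 2 * M" using a0 a[OF \<gamma>] by auto
    ultimately have "\<bar>a0 - a \<gamma>\<bar> * \<bar>t - t0\<bar> \<le> 2 * M * (\<epsilon> / \<delta>)" using M_nonneg by (intro mult_mono) auto
    then have "(a0 - a \<gamma>) * (t - t0) \<le> 2 * M * (\<epsilon> / \<delta>)"
      using abs_ge_self[of "(a0 - a \<gamma>) * (t - t0)"] by (simp add: abs_mult)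
    then have "\<theta> t \<le> f2 \<gamma> 1 t" using \<epsilon>_l by (simp add: \<theta>_def f2_def algebra_simps)
    then show ?thesis by (simp add: \<psi>_def f1_def \<theta>_def)
  next
    case False
    then have "\<theta> t \<le> perron x t" using d4(2)[of t] t r by (simp add: \<theta>_def)
    moreover have "\<psi> \<gamma> 1 t \<le> \<theta> t" by (simp add: \<psi>_def f1_def \<theta>_def)
    ultimately show ?thesis by simp
  qed
  obtain \<gamma>0 where \<gamma>0: "\<gamma>0 \<in> S" using arcs_into_nonempty[OF x] by (auto simp: S_def)
  have "\<psi> \<gamma>0 1 t0 \<le> perron (\<gamma>0 1) t0"
  proof (rule perron_above_bump[where S=S and r=r and \<sigma>=1 and ?t0.0=t0 and \<psi>=\<psi>])
    fix \<gamma>1 \<gamma>2 and s s' :: real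
    assume h: "\<gamma>1 \<in> S" "\<gamma>2 \<in> S" "s \<in> {0..1}" "s' \<in> {0..1}" "\<gamma>1 s = \<gamma>2 s'" "\<bar>s - 1\<bar> < r"
    have "s \<in> {0<..1}" using h r by auto
    then have meet: "s' = s" "s = 1 \<or> \<gamma>1 = \<gamma>2" using arcs_into_meet[of \<gamma>1 x \<gamma>2 s s'] h by (auto simp: S_def)
    then show "\<bar>s' - 1\<bar> < r \<and> (\<forall>t. \<bar>t - t0\<bar> < r \<longrightarrow>
        max (perron (\<gamma>1 s) t) (\<psi> \<gamma>1 s t) = max (perron (\<gamma>1 s) t) (\<psi> \<gamma>2 s' t))"
      using h(6) S(4)[OF h(1)] trace_eq[OF h(1)] trace_eq[OF h(2)] by (elim disjE) simp_all
  next
    fix \<gamma>1 \<gamma>2 and s s' :: real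
    assume h: "\<gamma>1 \<in> E" "\<gamma>1 \<notin> S" "reversepath \<gamma>1 \<notin> S" "\<gamma>2 \<in> S" "s \<in> {0..1}" "s' \<in> {0..1}" "\<bar>s' - 1\<bar> < r"
    then show "\<gamma>1 s \<noteq> \<gamma>2 s'" using r unfolding S_def by (intro arcs_into_apart) auto
  next
    fix \<gamma> \<alpha> \<beta> s t s' t'
    assume h: "\<gamma> \<in> S" "0 \<le> \<alpha>" "\<alpha> < \<beta>" "\<beta> \<le> 1" "s \<in> {\<alpha>..\<beta>}" "s' \<in> {\<alpha>..\<beta>}" "\<bar>s - 1\<bar> < r"
    have "increment_le (gradients (H \<gamma>) K \<alpha> \<beta>) (f1 \<gamma>) s t s' t'"
    proof (rule cone_increment[where b="u0 + \<epsilon>" and a=a0 and p="q \<gamma>" and e="2 * \<delta>" and r=r and \<sigma>=1 and ?t0.0=t0])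
      fix a' p' s assume "\<bar>a' - a0\<bar> \<le> 2 * \<delta>" "\<bar>p' - q \<gamma>\<bar> \<le> 2 * \<delta>" "s \<in> {0..1}" "\<bar>s - 1\<bar> < r"
      then show "a' + H \<gamma> s p' \<le> 0"
        using d1'(2)[OF h(1), of "2 * \<delta>", unfolded stable_def, rule_format, of a' p' s] \<delta> r by auto
    next
      show "- K \<le> a0 - 2 * \<delta>" using a0 \<delta> by (simp add: K_def)
    qed (use h \<delta> f1_def in auto)
    moreover have "increment_le (gradients (H \<gamma>) K \<alpha> \<beta>) (f2 \<gamma>) s t s' t'"
    proof (rule cone_increment[where b="u0 + l" and a="a \<gamma>" and p="p \<gamma>" and e="2 * \<delta>" and r=r and \<sigma>=1 and ?t0.0=t0])
      fix a' p' s assume "\<bar>a' - a \<gamma>\<bar> \<le> 2 * \<delta>" "\<bar>p' - p \<gamma>\<bar> \<le> 2 * \<delta>" "s \<in> {0..1}" "\<bar>s - 1\<bar> < r"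
      then show "a' + H \<gamma> s p' \<le> 0"
        using d1(2)[OF h(1), of "2 * \<delta>", unfolded stable_def, rule_format, of a' p' s] \<delta> r by auto
    next
      show "- K \<le> a \<gamma> - 2 * \<delta>" using a[OF h(1)] \<delta> by (simp add: K_def)
    qed (use h \<delta> f2_def in auto)
    ultimately have "increment_le (gradients (H \<gamma>) K \<alpha> \<beta>) (\<lambda>s t. min (f1 \<gamma> s t) (f2 \<gamma> s t)) s t s' t'"
      by (rule increment_le_min)
    then show "increment_le (gradients (H \<gamma>) K \<alpha> \<beta>) (\<psi> \<gamma>) s t s' t'" by (simp add: increment_le_def \<psi>_def)
  next
    fix \<gamma> s t
    assume h: "\<gamma> \<in> S" "s \<in> {0..1}" "\<bar>s - 1\<bar> < r" "\<bar>t - t0\<bar> < r" "\<bar>s - 1\<bar> \<ge> r / 2 \<or> \<bar>t - t0\<bar> \<ge> r / 2"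
    have "r / 2 \<le> \<bar>s - 1\<bar> + \<bar>t - t0\<bar>" using h(5) by linarith
    then have "\<delta> * (r / 2) \<le> \<delta> * (\<bar>s - 1\<bar> + \<bar>t - t0\<bar>)" using \<delta> by (intro mult_left_mono) auto
    moreover have "u0 + a \<gamma> * (t - t0) + p \<gamma> * (s - 1) - \<delta> * (\<bar>s - 1\<bar> + \<bar>t - t0\<bar>) \<le> perron (\<gamma> s) t"
      using d2(2)[OF h(1), of r, unfolded touching_def, rule_format, of s t] h r by auto
    \<comment> \<open>The space slope of \<open>f1\<close> comes from the flux limiter and has no
      relation to \<open>perron\<close>; here the minimum is controlled by
      \<open>f2\<close>.\<close>
    ultimately have "f2 \<gamma> s t \<le> perron (\<gamma> s) t" by (simp add: f2_def l_def algebra_simps)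
    then show "\<psi> \<gamma> s t \<le> perron (\<gamma> s) t" by (simp add: \<psi>_def)
  next
    fix \<gamma> and s :: real assume h: "\<gamma> \<in> S" "s \<in> {0..1}" "\<bar>s - 1\<bar> < r" "\<gamma> s \<in> vertices E"
    have "s \<notin> {0<..<1}" using vertex_not_interior[OF S(3)[OF h(1)]] h(4) by blast
    then have "s = 1" using h(2,3) r by auto
    moreover have "\<theta> t' - \<theta> t \<le> c x * (t' - t)" if tt: "t \<le> t'" for t t'
    proof -
      have "2 * \<delta> * (\<bar>t - t0\<bar> - \<bar>t' - t0\<bar>) \<le> 2 * \<delta> * (t' - t)" using tt \<delta> by (intro mult_left_mono) auto
      moreover have "(a0 + 2 * \<delta>) * (t' - t) \<le> c x * (t' - t)" using tt \<delta> by (intro mult_right_mono) auto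
      ultimately show ?thesis by (simp add: \<theta>_def algebra_simps)
    qed
    ultimately show "\<exists>\<theta>. (\<forall>t. \<bar>t - t0\<bar> < r \<longrightarrow> max (perron (\<gamma> s) t) (\<psi> \<gamma> s t) = max (perron (\<gamma> s) t) (\<theta> t)) \<and>
          (\<forall>t t'. t \<le> t' \<longrightarrow> \<theta> t' - \<theta> t \<le> c (\<gamma> s) * (t' - t))"
      using trace_eq[OF h(1)] S(4)[OF h(1)] by (intro exI[of _ \<theta>]) auto
  qed (use r d3 S \<gamma>0 in auto)
  \<comment> \<open>At the contact point the competitor exceeds \<open>perron\<close> by the minimum
    of \<open>\<epsilon>\<close> and \<open>l\<close>.\<close>
  then show False using \<epsilon> l S(4)[OF \<gamma>0] by (simp add: \<psi>_def f1_def f2_def u0_def)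
qed

lemma perron_supersolution: "hj_supersolution E H c T0 T1 perron"
  unfolding hj_supersolution_def
  using perron_continuous perron_supersolution_arc perron_supersolution_vertex by blast

end

section \<open>The Lipschitz bound and the existence theorem\<close>

text \<open>The infimum in \<open>M0\<close> is attained: the bounds
  \<open>Inf A + 1 / (n + 1)\<close> hold almost everywhere, for all \<open>n\<close> simultaneously
  by countability, and pass to the limit. The set \<open>A\<close> is nonempty because
  \<open>g\<close> has bounded slopes and \<open>H\<close> is bounded on compact sets.\<close>

lemma ae_le_M0:
  assumes N: "network E" and ham: "hamiltonians E H" and g: "lipschitz_space E g" and \<gamma>: "\<gamma> \<in> E"
  shows "AE s in lebesgue. 0 < s \<and> s < 1 \<longrightarrow> H \<gamma> s (deriv (g \<circ> \<gamma>) s) \<le> M0 E H c g"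
proof -
  define A where "A = {m. AE s\<in>{0<..<1} in lebesgue. H \<gamma> s (deriv (g \<circ> \<gamma>) s) \<le> m}"
  obtain L where L: "L-lipschitz_on {0..1} (g \<circ> \<gamma>)" using g \<gamma> by (auto simp: lipschitz_space_def)
  obtain G where G: "L-lipschitz_on UNIV G" "\<And>x. 0 < x \<Longrightarrow> x < 1 \<Longrightarrow> deriv G x = deriv (g \<circ> \<gamma>) x"
    using lipschitz_clamp[OF L] by metis
  have pos: "H \<gamma> s p > 0" if "s \<in> {0..1}" for s p using ham \<gamma> that by (auto simp: hamiltonians_def)
  have "A \<noteq> {}"
  proof -
    obtain \<rho> Z where Z: "negligible Z" "\<And>x. x \<notin> Z \<Longrightarrow> (G has_real_derivative \<rho> x) (at x)"
      by (rule lipschitz_has_derivative_ae[OF G(1)]) blast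
    have cont: "continuous_on ({0..1} \<times> UNIV) (\<lambda>(s, p). H \<gamma> s p)" using ham \<gamma> by (auto simp: hamiltonians_def)
    have "compact ((\<lambda>(s, p). H \<gamma> s p) ` ({0..1} \<times> {- L..L}))"
      by (intro compact_continuous_image continuous_on_subset[OF cont] compact_Times) auto
    then have "bdd_above ((\<lambda>(s, p). H \<gamma> s p) ` ({0..1} \<times> {- L..L}))" by (intro bounded_imp_bdd_above compact_imp_bounded)
    then obtain B where B: "\<And>s p. s \<in> {0..1} \<Longrightarrow> p \<in> {- L..L} \<Longrightarrow> H \<gamma> s p \<le> B"
      by (force simp: bdd_above_def)
    have "AE s in lebesgue. s \<notin> Z" using Z(1) by (intro AE_not_in) (simp add: negligible_iff_null_sets)
    then have "AE s\<in>{0<..<1} in lebesgue. H \<gamma> s (deriv (g \<circ> \<gamma>) s) \<le> B"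
    proof eventually_elim
      fix s assume s: "s \<notin> Z"
      show "s \<in> {0<..<1} \<longrightarrow> H \<gamma> s (deriv (g \<circ> \<gamma>) s) \<le> B"
      proof
        assume s1: "s \<in> {0<..<1}"
        have "\<bar>deriv (g \<circ> \<gamma>) s\<bar> \<le> L"
          using G(2)[of s] s1 DERIV_imp_deriv[OF Z(2)[OF s]] real_derivative_lipschitz_bound[OF G(1) Z(2)[OF s]] by auto
        then show "H \<gamma> s (deriv (g \<circ> \<gamma>) s) \<le> B" using s1 by (intro B) auto
      qed
    qed
    then show ?thesis by (auto simp: A_def)
  qed
  have "0 \<le> m" if "m \<in> A" for m
  proof -
    \<comment> \<open>A trivial instance of the increment bound on the unit interval; it expresses
      that an almost-everywhere bound on \<open>(0, 1)\<close> holds at some point, where positivity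
      of \<open>H\<close> applies.\<close>
    have "AE x in lebesgue. 0 < x \<and> x < 1 \<longrightarrow> 0 * deriv (\<lambda>x. 0::real) x \<le> m"
    proof -
      have "AE s\<in>{0<..<1} in lebesgue. H \<gamma> s (deriv (g \<circ> \<gamma>) s) \<le> m" using that by (simp add: A_def)
      then show ?thesis
      proof eventually_elim
        fix x assume "x \<in> {0<..<1} \<longrightarrow> H \<gamma> x (deriv (g \<circ> \<gamma>) x) \<le> m"
        then show "0 < x \<and> x < 1 \<longrightarrow> 0 * deriv (\<lambda>x. 0::real) x \<le> m"
          using pos[of x "deriv (g \<circ> \<gamma>) x"] by auto
      qed
    qed
    from lipschitz_increment_le[OF lipschitz_on_constant _ this] show "0 \<le> m" by simp
  qed
  then have "bdd_below A" by (intro bdd_belowI)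
  have "AE s in lebesgue. s \<in> {0<..<1} \<longrightarrow> H \<gamma> s (deriv (g \<circ> \<gamma>) s) \<le> Inf A + 1 / real (Suc n)" for n
  proof -
    have "Inf A < Inf A + 1 / real (Suc n)" by simp
    then obtain m where m: "m \<in> A" "m < Inf A + 1 / real (Suc n)" using cInf_lessD[OF \<open>A \<noteq> {}\<close>] by blast
    have "AE s\<in>{0<..<1} in lebesgue. H \<gamma> s (deriv (g \<circ> \<gamma>) s) \<le> m" using m by (simp add: A_def)
    then show ?thesis by eventually_elim (use m in auto)
  qed
  then have lim: "AE s in lebesgue. \<forall>n. s \<in> {0<..<1} \<longrightarrow> H \<gamma> s (deriv (g \<circ> \<gamma>) s) \<le> Inf A + 1 / real (Suc n)"
    unfolding AE_all_countable by blast
  have "Inf A \<le> M0 E H c g"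
  proof -
    have "finite E" using N by (simp add: network_def)
    then have "Inf A \<le> (MAX \<gamma>\<in>E. Inf {m. AE s\<in>{0<..<1} in lebesgue. H \<gamma> s (deriv (g \<circ> \<gamma>) s) \<le> m})"
      unfolding A_def using \<gamma> by (intro Max_ge) auto
    then show ?thesis by (simp add: M0_def)
  qed
  show ?thesis
    using lim
  proof eventually_elim
    fix s assume s: "\<forall>n. s \<in> {0<..<1} \<longrightarrow> H \<gamma> s (deriv (g \<circ> \<gamma>) s) \<le> Inf A + 1 / real (Suc n)"
    show "0 < s \<and> s < 1 \<longrightarrow> H \<gamma> s (deriv (g \<circ> \<gamma>) s) \<le> M0 E H c g"
    proof
      assume "0 < s \<and> s < 1"
      have "(\<lambda>n. Inf A + 1 / real (Suc n)) \<longlonglongrightarrow> Inf A + 0"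
        by (intro tendsto_intros LIMSEQ_Suc[OF lim_1_over_n])
      then have "H \<gamma> s (deriv (g \<circ> \<gamma>) s) \<le> Inf A + 0"
        using s \<open>0 < s \<and> s < 1\<close> by (intro LIMSEQ_le_const) auto
      then show "H \<gamma> s (deriv (g \<circ> \<gamma>) s) \<le> M0 E H c g" using \<open>Inf A \<le> M0 E H c g\<close> by simp
    qed
  qed
qed

theorem theorem7p4:
  fixes E :: "(real \<Rightarrow> real ^ 'n) set"
    and H :: "(real \<Rightarrow> real ^ 'n) \<Rightarrow> real \<Rightarrow> real \<Rightarrow> real"
    and c g :: "real ^ 'n \<Rightarrow> real"
    and T0 :: real and T1 :: ereal
  assumes "0 \<le> T0" and "ereal T0 < T1"
    and "network E"
    and "hamiltonians E H"
    and "flux_limiter E H c"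
    and "lipschitz_space E g"
  shows "\<exists>u. hj_solution E H c T0 T1 u \<and>
             lipschitz_spacetime E T0 T1 u \<and>
             (\<forall>x\<in>support E. u x T0 = g x) \<and>
             (\<forall>\<gamma>\<in>E. \<forall>s\<in>{0..1}. (M0 E H c g)-lipschitz_on (time_halfopen T0 T1) (\<lambda>t. u (\<gamma> s) t))"
\<comment> \<open>Without arcs \<open>M0\<close> is built from maxima of empty sets and hence
  unspecified; the claims are then vacuous.\<close>
proof (cases "E = {}")
  case True
  then show ?thesis
    by (auto simp: hj_solution_def hj_subsolution_def hj_supersolution_def lipschitz_spacetime_def
        support_def vertices_def)
next
  case False
  have fin: "finite E" using assms(3) by (simp add: network_def)
  then have finV: "finite (vertices E)" by (simp add: vertices_def)
  define M where "M = M0 E H c g"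
  \<comment> \<open>The level \<open>M + 2\<close> makes the bound above \<open>K = M + 1\<close>
    strict.\<close>
  have "\<forall>\<gamma>\<in>E. \<exists>R. \<forall>s\<in>{0..1}. \<forall>p. \<bar>p\<bar> \<ge> R \<longrightarrow> H \<gamma> s p \<ge> M + 2"
    using assms(4) unfolding hamiltonians_def by blast
  then obtain \<rho> where \<rho>: "\<And>\<gamma> s p. \<gamma> \<in> E \<Longrightarrow> s \<in> {0..1} \<Longrightarrow> \<bar>p\<bar> \<ge> \<rho> \<gamma> \<Longrightarrow> H \<gamma> s p \<ge> M + 2" by metis
  define R where "R = Max (insert 0 (\<rho> ` E))"
  have R: "0 \<le> R" "\<And>\<gamma>. \<gamma> \<in> E \<Longrightarrow> \<rho> \<gamma> \<le> R" using fin by (auto simp: R_def)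
  interpret hj_network E H c g T0 T1 M R
  proof
    fix x assume "x \<in> vertices E"
    then have "\<bar>c x\<bar> \<le> (MAX x\<in>vertices E. \<bar>c x\<bar>)" using finV by (intro Max_ge) auto
    then show "\<bar>c x\<bar> \<le> M" by (simp add: M_def M0_def)
  next
    fix \<gamma> assume "\<gamma> \<in> E"
    then show "AE s in lebesgue. 0 < s \<and> s < 1 \<longrightarrow> H \<gamma> s (deriv (g \<circ> \<gamma>) s) \<le> M"
      unfolding M_def by (rule ae_le_M0[OF assms(3,4,6)])
  next
    fix \<gamma> s p assume "\<gamma> \<in> E" "s \<in> {0..1::real}" "\<bar>p\<bar> \<ge> R"
    then show "H \<gamma> s p > M + 1" using \<rho>[of \<gamma> s p] R(2)[of \<gamma>] by simp
  qed (use assms False R in auto)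
  show ?thesis
    using perron_subsolution perron_supersolution perron_lipschitz perron_initial
      perron_lipschitz_time[OF arc_in_support]
    unfolding hj_solution_def M_def[symmetric] by (intro exI[of _ perron]) blast
qed

end
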